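(* Let $\gamma>0$, $\lambda=e^{-\gamma}$ and $c=2\sqrt{\pi}$. For real $\beta\neq0$ the operators $$\mathcal{L}_\beta:\mathcal{H}L^2(\mathbb{C},\mu_{\frac{|\beta|}{\pi}})\to\mathcal{H}L^2(\mathbb{C},\mu_{\frac{|\beta|}{\pi}})$$ and $$\frac{1}{\sqrt{\lambda\exp\beta}}\;m_{\cosh(2\sqrt{\beta\pi}x)}\circ\mathcal{K}_c'':L^2(\mathbb{R},dx)\to L^2(\mathbb{R},dx)$$ are conjugate operators.
   Context: For $t>0$, $\mathcal{H}L^2(\mathbb{C},\mu_t)$ is the Hilbert space of entire functions $F$ on $\mathbb{C}$ with $\int_{\mathbb{C}}|F(z)|^2\mu_t(z)\,dz<\infty$, where $\mu_t(z)=t\exp(-\pi t|z|^2)$. The Ruelle operator is $(\mathcal{L}_\beta F)(z)=e^{\beta z}F(\lambda+\lambda z)+e^{-\beta z}F(-\lambda+\lambda z)$. $m_g$ denotes multiplication by $g$; for $\beta<0$, $\cosh(2\sqrt{\beta\pi}x)=\cos(2\sqrt{|\beta|\pi}x)$. $\mathcal{K}_c''$ is the integral operator on $L^2(\mathbb{R},dx)$ with kernel $\mathcal{K}_c''(x,y)=2\sum_{k=0}^\infty e^{-(k+\frac12)\gamma}h_k(x)h_k(y)$, where $h_0(x)=2^{1/4}e^{-\pi x^2}$, $h_k=\sqrt{\pi^k/k!}\,(Z^* )^kh_0$, $Z^*f(x)=xf(x)-\frac{1}{2\pi}f'(x)$ are the Hermite functions, which form a Hilbert basis of $L^2(\mathbb{R},dx)$.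 Two operators $S$ on $H_1$ and $T$ on $H_2$ are conjugate if there is a Hilbert space isomorphism $U:H_2\to H_1$ with $S=U\circ T\circ U^{-1}$. *)

theory Defs
  imports "HOL-Analysis.Analysis"
begin

text \<open>Complex inner product spaces with an explicit carrier (the weight of the space of entire
  functions below is a real parameter, so it cannot be a type).\<close>

record 'a inner_space =
  carrier :: "'a set"
  plus :: "'a \<Rightarrow> 'a \<Rightarrow> 'a"
  scale :: "complex \<Rightarrow> 'a \<Rightarrow> 'a"
  inner_prod :: "'a \<Rightarrow> 'a \<Rightarrow> complex"

definition hilbert_iso :: "'a inner_space \<Rightarrow> 'b inner_space \<Rightarrow> ('a \<Rightarrow> 'b) \<Rightarrow> bool" where
  "hilbert_iso H K U \<longleftrightarrow>
     bij_betw U (carrier H) (carrier K) \<and>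
     (\<forall>f\<in>carrier H. \<forall>g\<in>carrier H. U (plus H f g) = plus K (U f) (U g)) \<and>
     (\<forall>a. \<forall>f\<in>carrier H. U (scale H a f) = scale K a (U f)) \<and>
     (\<forall>f\<in>carrier H. \<forall>g\<in>carrier H. inner_prod K (U f) (U g) = inner_prod H f g)"

definition conjugate_operators ::
  "'a inner_space \<Rightarrow> ('a \<Rightarrow> 'a) \<Rightarrow> 'b inner_space \<Rightarrow> ('b \<Rightarrow> 'b) \<Rightarrow> bool" where
  "conjugate_operators H1 S H2 T \<longleftrightarrow>
     S \<in> carrier H1 \<rightarrow> carrier H1 \<and> T \<in> carrier H2 \<rightarrow> carrier H2 \<and>
     (\<exists>U. hilbert_iso H2 H1 U \<and>
          (\<forall>F\<in>carrier H1. S F = (U \<circ> T \<circ> inv_into (carrier H2) U) F))"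

definition sq_integrable :: "(real \<Rightarrow> complex) \<Rightarrow> bool" where
  "sq_integrable f \<longleftrightarrow>
     f \<in> borel_measurable lborel \<and> integrable lborel (\<lambda>x. (cmod (f x))\<^sup>2)"

definition ae_rel :: "((real \<Rightarrow> complex) \<times> (real \<Rightarrow> complex)) set" where
  "ae_rel = {(f, g). sq_integrable f \<and> sq_integrable g \<and> (AE x in lborel. f x = g x)}"

text \<open>Elements of \<open>L2\<close> are classes of functions modulo equality almost everywhere. A map
  on functions acts on classes through representatives. If it leads outside the
  square-integrable functions the result is the empty set, which is not an element of the space.\<close>

definition L2_lift :: "((real \<Rightarrow> complex) \<Rightarrow> (real \<Rightarrow> complex)) \<Rightarrow>
    (real \<Rightarrow> complex) set \<Rightarrow> (real \<Rightarrow> complex) set" where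
  "L2_lift \<Phi> A = (\<Union>f\<in>A. ae_rel `` {\<Phi> f})"

definition L2 :: "(real \<Rightarrow> complex) set inner_space" where
  "L2 = \<lparr> carrier = Collect sq_integrable // ae_rel,
          plus = (\<lambda>A B. \<Union>f\<in>A. \<Union>g\<in>B. ae_rel `` {\<lambda>x. f x + g x}),
          scale = (\<lambda>a. L2_lift (\<lambda>f x. a * f x)),
          inner_prod = (\<lambda>A B. the_elem (\<Union>f\<in>A. \<Union>g\<in>B. {LINT x|lborel. f x * cnj (g x)})) \<rparr>"

definition mult_op :: "(real \<Rightarrow> real) \<Rightarrow> (real \<Rightarrow> complex) set \<Rightarrow> (real \<Rightarrow> complex) set" where
  "mult_op g = L2_lift (\<lambda>f x. complex_of_real (g x) * f x)"

definition integral_op :: "(real \<Rightarrow> real \<Rightarrow> real) \<Rightarrow>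
    (real \<Rightarrow> complex) set \<Rightarrow> (real \<Rightarrow> complex) set" where
  "integral_op k = L2_lift (\<lambda>f x. LINT y|lborel. complex_of_real (k x y) * f y)"

definition mu :: "real \<Rightarrow> complex \<Rightarrow> real" where
  "mu t z = t * exp (- pi * t * (cmod z)\<^sup>2)"

definition HL2 :: "real \<Rightarrow> (complex \<Rightarrow> complex) inner_space" where
  "HL2 t = \<lparr> carrier = {F. F holomorphic_on UNIV \<and>
                           integrable lborel (\<lambda>z. (cmod (F z))\<^sup>2 * mu t z)},
             plus = (\<lambda>F G z. F z + G z),
             scale = (\<lambda>a F z. a * F z),
             inner_prod = (\<lambda>F G. LINT z|lborel. F z * cnj (G z) * complex_of_real (mu t z)) \<rparr>"

definition ruelle :: "real \<Rightarrow> real \<Rightarrow> (complex \<Rightarrow> complex) \<Rightarrow> complex \<Rightarrow> complex" where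
  "ruelle l \<beta> F z =
     exp (of_real \<beta> * z) * F (of_real l + of_real l * z) +
     exp (- of_real \<beta> * z) * F (- of_real l + of_real l * z)"

definition Z_star :: "(real \<Rightarrow> real) \<Rightarrow> real \<Rightarrow> real" where
  "Z_star f x = x * f x - 1 / (2 * pi) * deriv f x"

definition hermite0 :: "real \<Rightarrow> real" where
  "hermite0 x = 2 powr (1/4) * exp (- pi * x\<^sup>2)"

definition hermite :: "nat \<Rightarrow> real \<Rightarrow> real" where
  "hermite k x = sqrt (pi ^ k / fact k) * (Z_star ^^ k) hermite0 x"

definition kac_kernel :: "real \<Rightarrow> real \<Rightarrow> real \<Rightarrow> real" where
  "kac_kernel \<gamma> x y = 2 * (\<Sum>k. exp (- (real k + 1/2) * \<gamma>) * hermite k x * hermite k y)"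

text \<open>\<open>cosh (2 * sqrt (\<beta> * pi) * x)\<close> with an imaginary square root for \<open>\<beta> < 0\<close>; the real
  \<open>sqrt\<close> of the library is odd and would give the wrong function there.\<close>

definition cosh_weight :: "real \<Rightarrow> real \<Rightarrow> real" where
  "cosh_weight \<beta> x =
     (if \<beta> \<ge> 0 then cosh (2 * sqrt (\<beta> * pi) * x) else cos (2 * sqrt (\<bar>\<beta>\<bar> * pi) * x))"

end

theory Submission
  imports Defs "HOL-Probability.Levy" "HOL-Complex_Analysis.Cauchy_Integral_Formula"
begin

text \<open>Choose \<open>s\<close> with \<open>pi * s\<^sup>2 = \<beta>\<close> (imaginary if \<open>\<beta> < 0\<close>) and let \<open>B\<close> be the Bargmann transform, whose
  kernel \<open>A z x\<close> is the generating function of the Hermite functions. The conjugation is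
  \<open>f \<mapsto> (\<lambda>z. B f (s * z))\<close>: it sends the \<open>k\<close>-th Hermite function to a monomial of degree \<open>k\<close>, so the
  Kac operator turns into the dilation by \<open>exp (- \<gamma>)\<close>. Completing the square gives
  \<open>A (s * z) x * exp (2 * pi * s * x) = exp (\<beta> * z + \<beta> / 2) * A (s * (z + 1)) x\<close>, so
  \<open>cosh (2 * pi * s * x)\<close> turns into the two weighted translations of the Ruelle operator.

  Unitarity comes down to two facts. Averaging over rotations and Parseval on circles compute the
  Gaussian norm of an entire function from its Taylor coefficients. The Hermite functions are
  complete, because a function orthogonal to all of them has a Bargmann transform equal to zero,
  hence after multiplication by a Gaussian a Fourier transform equal to zero.\<close>

subsection \<open>Gaussian integrals and rotations of the plane\<close>

text \<open>For \<open>\<beta> > 0\<close> the weight is unbounded and does not multiply L2 into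
  itself; only its composition with the Kac operator is defined everywhere. This rests on a Gaussian
  bound for every function in the range of that operator, and the bound rests on
  \<open>\<bar>hermite k x\<bar> * r ^ k \<le> C * exp (- d * x\<^sup>2)\<close>, uniform in
  \<open>k\<close>, for each \<open>r < 1\<close>: the eigenvalues decay geometrically, and part of
  that decay is traded for decay in \<open>x\<close>. The same estimate justifies the exchanges of
  integrals with Hermite series. It comes from the Gaussian norm formula itself: for fixed
  \<open>x\<close> the Hermite values are normalized Taylor coefficients of the Bargmann kernel, and
  one term is at most the whole sum.

  The norm formula is an identity in [0, infinity]. Hence it also decides membership in the space of
  entire functions, and together with Riesz-Fischer it gives surjectivity.

  The prefactor has three sources: the Kac operator contributes
  \<open>2 * exp (- \<gamma> / 2)\<close>, writing cosh as a mean of two exponentials contributes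
  1/2, and completing the square contributes \<open>exp (\<beta> / 2)\<close>. The product is
  \<open>sqrt (l * exp \<beta>)\<close>.\<close>

lemma lborel_complex_eq_distr_pair:
  "(lborel :: complex measure) = distr (lborel \<Otimes>\<^sub>M lborel) borel (\<lambda>(x, y). Complex x y)"
proof (rule lborel_eqI)
  fix a b :: complex
  assume le: "\<And>e. e \<in> Basis \<Longrightarrow> a \<bullet> e \<le> b \<bullet> e"
  have [measurable]: "(\<lambda>(x, y). Complex x y) \<in> lborel \<Otimes>\<^sub>M lborel \<rightarrow>\<^sub>M borel"
    unfolding Complex_eq by measurable
  have pre: "(\<lambda>(x, y). Complex x y) -` box a b = {Re a<..<Re b} \<times> {Im a<..<Im b}"
    by (auto simp: box_def Basis_complex_def)
  have "emeasure (distr (lborel \<Otimes>\<^sub>M lborel) borel (\<lambda>(x, y). Complex x y)) (box a b)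
      = emeasure (lborel \<Otimes>\<^sub>M lborel) ({Re a<..<Re b} \<times> {Im a<..<Im b})"
    by (subst emeasure_distr) (auto simp: pre space_pair_measure)
  also have "\<dots> = emeasure lborel {Re a<..<Re b} * emeasure lborel {Im a<..<Im b}"
    by (rule lborel.emeasure_pair_measure_Times) auto
  also have "\<dots> = ennreal (\<Prod>e\<in>Basis. (b - a) \<bullet> e)"
    using le[of 1] le[of \<i>] by (auto simp: Basis_complex_def ennreal_mult')
  finally show "emeasure (distr (lborel \<Otimes>\<^sub>M lborel) borel (\<lambda>(x, y). Complex x y)) (box a b)
      = ennreal (\<Prod>e\<in>Basis. (b - a) \<bullet> e)" .
qed simp

lemma measurable_Complex[measurable]:
  assumes [measurable]: "f \<in> borel_measurable M" "g \<in> borel_measurable M"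
  shows "(\<lambda>x. Complex (f x) (g x)) \<in> borel_measurable M"
  unfolding Complex_eq by measurable

text \<open>Both orders are used below: a horizontal shear is undone in an inner integral over the
  real part, a vertical shear in an inner integral over the imaginary part.\<close>

lemma nn_integral_complex_iterated:
  fixes f :: "complex \<Rightarrow> ennreal"
  assumes [measurable]: "f \<in> borel_measurable borel"
  shows "(\<integral>\<^sup>+z. f z \<partial>lborel) = (\<integral>\<^sup>+y. \<integral>\<^sup>+x. f (Complex x y) \<partial>lborel \<partial>lborel)" (is ?th1)
    and "(\<integral>\<^sup>+z. f z \<partial>lborel) = (\<integral>\<^sup>+x. \<integral>\<^sup>+y. f (Complex x y) \<partial>lborel \<partial>lborel)" (is ?th2)
proof -
  have *: "(\<integral>\<^sup>+z. f z \<partial>lborel) = (\<integral>\<^sup>+p. f (case p of (x, y) \<Rightarrow> Complex x y) \<partial>(lborel \<Otimes>\<^sub>M lborel))"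
    by (subst lborel_complex_eq_distr_pair, subst nn_integral_distr) auto
  show ?th1
    unfolding * by (subst lborel_pair.nn_integral_snd[symmetric]) auto
  show ?th2
    unfolding * by (subst lborel.nn_integral_fst[symmetric]) auto
qed

lemma nn_integral_real_translate:
  fixes f :: "real \<Rightarrow> ennreal"
  assumes "f \<in> borel_measurable borel"
  shows "(\<integral>\<^sup>+x. f (x + a) \<partial>lborel) = (\<integral>\<^sup>+x. f x \<partial>lborel)"
  using nn_integral_real_affine[OF assms, of 1 a] by (simp add: add.commute)

text \<open>A rotation by an angle that is not a multiple of \<open>pi\<close> is a product of three shears, and a
  shear preserves Lebesgue measure by translation invariance in one coordinate.\<close>

lemma nn_integral_complex_rotate:
  fixes f :: "complex \<Rightarrow> ennreal"
  assumes [measurable]: "f \<in> borel_measurable borel" and u: "cmod u = 1"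
  shows "(\<integral>\<^sup>+z. f (u * z) \<partial>lborel) = (\<integral>\<^sup>+z. f z \<partial>lborel)"
proof -
  have shear1: "(\<integral>\<^sup>+z. g (Complex (Re z + a * Im z) (Im z)) \<partial>lborel) = (\<integral>\<^sup>+z. g z \<partial>lborel)"
    if [measurable]: "g \<in> borel_measurable borel" for g :: "complex \<Rightarrow> ennreal" and a
    by (simp add: nn_integral_complex_iterated(1)
        nn_integral_real_translate[where f = "\<lambda>x. g (Complex x y)" for y])
  have shear2: "(\<integral>\<^sup>+z. g (Complex (Re z) (Im z + b * Re z)) \<partial>lborel) = (\<integral>\<^sup>+z. g z \<partial>lborel)"
    if [measurable]: "g \<in> borel_measurable borel" for g :: "complex \<Rightarrow> ennreal" and b
    by (simp add: nn_integral_complex_iterated(2)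
        nn_integral_real_translate[where f = "\<lambda>y. g (Complex x y)" for x])
  have main: "(\<integral>\<^sup>+z. g (v * z) \<partial>lborel) = (\<integral>\<^sup>+z. g z \<partial>lborel)"
    if [measurable]: "g \<in> borel_measurable borel" and v: "cmod v = 1" "Im v \<noteq> 0"
    for g :: "complex \<Rightarrow> ennreal" and v
  proof -
    \<comment> \<open>The rotation is the horizontal shear \<open>a\<close>, the vertical shear
      \<open>b\<close> and the horizontal shear \<open>a\<close> again. Here \<open>b\<close> is the
      sine of the angle and \<open>a\<close> is minus the tangent of its half, so that
      \<open>1 + a * b\<close> is the cosine.\<close>
    define a where "a = (Re v - 1) / Im v"
    define b where "b = Im v"
    have sq: "(Re v)\<^sup>2 + (Im v)\<^sup>2 = 1"
      using v(1) by (simp add: cmod_def)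
    have "(\<integral>\<^sup>+z. g z \<partial>lborel) = (\<integral>\<^sup>+z. g (Complex (Re z + a * Im z) (Im z)) \<partial>lborel)"
      by (rule shear1[symmetric]) fact
    also have "\<dots> = (\<integral>\<^sup>+z. g (Complex (Re z + a * (Im z + b * Re z)) (Im z + b * Re z)) \<partial>lborel)"
      by (subst shear2[of _ b, symmetric]) auto
    also have "\<dots> = (\<integral>\<^sup>+z. g (Complex ((Re z + a * Im z) + a * (Im z + b * (Re z + a * Im z)))
        (Im z + b * (Re z + a * Im z))) \<partial>lborel)"
      by (subst shear1[of _ a, symmetric]) auto
    also have "(\<lambda>z. Complex ((Re z + a * Im z) + a * (Im z + b * (Re z + a * Im z)))
        (Im z + b * (Re z + a * Im z))) = (\<lambda>z. v * z)"
    proof (rule ext, rule complex_eqI)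
      fix z
      have ab: "a * b = Re v - 1"
        using v(2) by (simp add: a_def b_def)
      have "a * (1 + Re v) = ((Re v)\<^sup>2 - 1) / Im v"
        using v(2) by (simp add: a_def field_simps power2_eq_square)
      also have "\<dots> = - Im v"
        using v(2) sq by (simp add: field_simps power2_eq_square)
      finally have a2: "a * (1 + Re v) = - Im v" .
      have "(Re z + a * Im z) + a * (Im z + b * (Re z + a * Im z))
          = (1 + a * b) * Re z + a * (2 + a * b) * Im z"
        by (simp add: algebra_simps)
      also have "\<dots> = Re v * Re z - Im v * Im z"
        using a2 by (simp add: ab)
      finally show "Re (Complex ((Re z + a * Im z) + a * (Im z + b * (Re z + a * Im z)))
          (Im z + b * (Re z + a * Im z))) = Re (v * z)" by simp
      have "Im z + b * (Re z + a * Im z) = b * Re z + (1 + a * b) * Im z"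
        by (simp add: algebra_simps)
      then show "Im (Complex ((Re z + a * Im z) + a * (Im z + b * (Re z + a * Im z)))
          (Im z + b * (Re z + a * Im z))) = Im (v * z)"
        by (simp add: ab) (simp add: b_def)
    qed
    finally show ?thesis by (simp add: fun_eq_iff)
  qed
  show ?thesis
  proof (cases "Im u = 0")
    case True
    then have "u = 1 \<or> u = - 1"
      using u by (auto simp: complex_eq_iff cmod_eq_Re)
    \<comment> \<open>A half turn is two quarter turns, and the shear argument covers those.\<close>
    moreover have "(\<integral>\<^sup>+z. f (- z) \<partial>lborel) = (\<integral>\<^sup>+z. f z \<partial>lborel)"
      using main[of "\<lambda>z. f (\<i> * z)" \<i>] main[of f \<i>] by simp
    ultimately show ?thesis by auto
  qed (use main u in auto)
qed

lemma nn_integral_gaussian_real: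
  fixes a :: real assumes "a > 0"
  shows "(\<integral>\<^sup>+x. ennreal (exp (- a * x\<^sup>2)) \<partial>lborel) = ennreal (sqrt (pi / a))"
proof -
  define \<sigma> where "\<sigma> = sqrt (1 / (2 * a))"
  have s: "\<sigma> > 0" "\<sigma>\<^sup>2 = 1 / (2 * a)"
    using assms by (auto simp: \<sigma>_def)
  have eq: "exp (- a * x\<^sup>2) = sqrt (pi / a) * normal_density 0 \<sigma> x" for x
    using assms unfolding normal_density_def s by (simp add: field_simps real_sqrt_divide)
  have "(\<integral>\<^sup>+x. ennreal (normal_density 0 \<sigma> x) \<partial>lborel) = 1"
    using s by (subst nn_integral_eq_integral)
      (auto intro: integrable_normal_density integral_normal_density)
  then show ?thesis
    unfolding eq using assms by (simp add: ennreal_mult' nn_integral_cmult)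
qed

lemma nn_integral_gaussian_complex:
  fixes a :: real assumes "a > 0"
  shows "(\<integral>\<^sup>+z. ennreal (exp (- a * (cmod z)\<^sup>2)) \<partial>lborel) = ennreal (pi / a)"
proof -
  have eq: "ennreal (exp (- a * (cmod (Complex x y))\<^sup>2))
      = ennreal (exp (- a * y\<^sup>2)) * ennreal (exp (- a * x\<^sup>2))" for x y
    by (simp add: cmod_power2 ennreal_mult' [symmetric] exp_add [symmetric] algebra_simps)
  have "(\<integral>\<^sup>+z. ennreal (exp (- a * (cmod z)\<^sup>2)) \<partial>lborel)
      = (\<integral>\<^sup>+y. \<integral>\<^sup>+x. ennreal (exp (- a * (cmod (Complex x y))\<^sup>2)) \<partial>lborel \<partial>lborel)"
    by (rule nn_integral_complex_iterated) measurable
  also have "\<dots> = ennreal (sqrt (pi / a)) * ennreal (sqrt (pi / a))"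
    unfolding eq using nn_integral_gaussian_real[OF assms]
    by (simp add: nn_integral_cmult nn_integral_multc)
  also have "\<dots> = ennreal (pi / a)"
    using assms by (simp add: ennreal_mult' [symmetric])
  finally show ?thesis .
qed

subsection \<open>Gaussian norms of entire functions\<close>

text \<open>A nonzero difference would have an isolated zero at 0, yet it vanishes on all of (0, r).
  The one-sided form fits generating functions with nonnegative terms, which are evaluated at
  positive arguments only.\<close>

lemma powser_unique_at_right:
  fixes c d :: "nat \<Rightarrow> real"
  assumes "r > 0"
    and eq: "\<And>x. 0 < x \<Longrightarrow> x < r \<Longrightarrow> (\<lambda>n. c n * x ^ n) sums f x \<and> (\<lambda>n. d n * x ^ n) sums f x"
  shows "c = d"
proof (rule ccontr)
  assume "c \<noteq> d"
  then obtain m where m: "c m - d m \<noteq> 0" by (auto simp: fun_eq_iff)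
  define b where "b n = c n - d n" for n
  \<comment> \<open>Shifting the index multiplies the series by \<open>x\<close>. It then vanishes
    at 0, and the nonzero coefficient gets a positive index, whatever the constant term of the
    difference is.\<close>
  define a where "a n = (case n of 0 \<Rightarrow> 0 | Suc k \<Rightarrow> b k)" for n
  have b: "(\<lambda>n. b n * x ^ n) sums 0" if "0 < x" "x < r" for x
    using sums_diff[OF eq[OF that, THEN conjunct1] eq[OF that, THEN conjunct2]]
    by (simp add: b_def algebra_simps)
  have sb: "summable (\<lambda>n. b n * x ^ n)" if "\<bar>x\<bar> < r" for x
  proof -
    from that obtain y where y: "\<bar>x\<bar> < y" "y < r" using dense by blast
    then have "summable (\<lambda>n. b n * y ^ n)" using b[of y] by (auto simp: sums_iff)
    then show ?thesis using y by (intro powser_inside[of b y x]) auto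
  qed
  have a: "(\<lambda>n. a n * x ^ n) sums (x * (\<Sum>n. b n * x ^ n))" if "\<bar>x\<bar> < r" for x
  proof -
    have "(\<lambda>n. a (Suc n) * x ^ Suc n) sums (x * (\<Sum>n. b n * x ^ n))"
      using sums_mult[OF summable_sums[OF sb[OF that]], of x] by (simp add: a_def ac_simps)
    then show ?thesis by (subst (asm) sums_Suc_iff) (simp add: a_def)
  qed
  obtain s where s: "s > 0" "\<And>z. z \<in> cball 0 s - {0} \<Longrightarrow> z * (\<Sum>n. b n * z ^ n) \<noteq> 0"
    using powser_0_nonzero[of r 0 a "\<lambda>x. x * (\<Sum>n. b n * x ^ n)" "Suc m"] \<open>r > 0\<close> a m
    by (auto simp: a_def b_def)
  define y where "y = min s (r / 2)"
  have "0 < y" "y < r" "y \<le> s" using s(1) \<open>r > 0\<close> by (auto simp: y_def)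
  then show False using s(2)[of y] b[of y] by (auto simp: sums_iff)
qed

lemma integral_cis_period:
  fixes m :: int
  shows "(LINT \<theta>|restrict_space lborel {0..2*pi}. cis (of_int m * \<theta>)) = (if m = 0 then 2 * pi else 0)"
proof -
  have cont: "continuous_on {0..2*pi} (\<lambda>\<theta>. cis (of_int m * \<theta>))"
    by (intro continuous_intros)
  have hi: "((\<lambda>\<theta>. cis (of_int m * \<theta>)) has_integral (if m = 0 then of_real (2 * pi) else 0)) {0..2*pi}"
  proof (cases "m = 0")
    case True
    then show ?thesis using has_integral_const_real[of "1::complex" 0 "2*pi"] by (simp add: scaleR_conv_of_real)
  next
    case False
    have "((\<lambda>\<theta>. cis (of_int m * \<theta>)) has_integral
        (cis (of_int m * (2 * pi)) / (\<i> * of_int m) - cis (of_int m * 0) / (\<i> * of_int m))) {0..2*pi}"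
    proof (rule fundamental_theorem_of_calculus)
      fix x
      show "((\<lambda>\<theta>. cis (of_int m * \<theta>) / (\<i> * of_int m)) has_vector_derivative cis (of_int m * x))
          (at x within {0..2*pi})"
      proof -
        have "((\<lambda>w. exp (\<i> * of_int m * w) / (\<i> * of_int m)) has_field_derivative exp (\<i> * of_int m * of_real x))
            (at (of_real x))"
          using False by (auto intro!: derivative_eq_intros)
        from has_vector_derivative_real_field[OF this] show ?thesis
          by (simp add: cis_conv_exp mult_ac)
      qed
    qed simp
    moreover have "cis (of_int m * (2 * pi)) = 1"
      by (metis cis_multiple_2pi Ints_of_int mult.commute mult.left_commute)
    ultimately show ?thesis using False by simp
  qed
  have si: "set_integrable lborel {0..2*pi} (\<lambda>\<theta>. cis (of_int m * \<theta>))"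
    by (rule borel_integrable_atLeastAtMost') (rule cont)
  show ?thesis
    using hi set_borel_integral_eq_integral(2)[OF si]
    by (auto simp: integral_restrict_space set_lebesgue_integral_def dest: integral_unique)
qed

text \<open>Parseval on a circle: orthogonality of the characters settles the partial sums, and
  dominated convergence passes to the limit, since all of them are bounded by the sum of the
  \<open>cmod (a k)\<close>.\<close>

lemma nn_integral_trig_series:
  fixes a :: "nat \<Rightarrow> complex"
  assumes a: "summable (\<lambda>k. cmod (a k))"
  shows "(\<integral>\<^sup>+\<theta>. ennreal ((cmod (\<Sum>k. a k * cis (of_nat k * \<theta>)))\<^sup>2) \<partial>restrict_space lborel {0..2*pi})
      = ennreal (2 * pi) * (\<Sum>k. ennreal ((cmod (a k))\<^sup>2))"
proof -
  \<comment> \<open>As a finite measure on one period, \<open>M\<close> makes every bounded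
    measurable function integrable.\<close>
  define M where "M = restrict_space (lborel :: real measure) {0..2*pi}"
  have emM: "emeasure M (space M) = ennreal (2 * pi)"
    by (simp add: M_def emeasure_restrict_space space_restrict_space)
  interpret M: finite_measure M by standard (simp add: emM)
  have measM: "f \<in> borel_measurable M" if "f \<in> borel_measurable borel"
    for f :: "real \<Rightarrow> 'b::topological_space"
    using that by (simp add: M_def measurable_restrict_space1)
  define S where "S n \<theta> = (\<Sum>k<n. a k * cis (of_nat k * \<theta>))" for n \<theta>
  define F where "F \<theta> = (\<Sum>k. a k * cis (of_nat k * \<theta>))" for \<theta>
  have [measurable]: "S n \<in> borel_measurable borel" for n
    unfolding S_def by (intro borel_measurable_continuous_onI continuous_intros)
  have sF: "(\<lambda>k. a k * cis (of_nat k * \<theta>)) sums F \<theta>" for \<theta>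
    unfolding F_def by (rule summable_sums, rule summable_norm_cancel) (simp add: norm_mult a)
  then have lim: "(\<lambda>n. S n \<theta>) \<longlonglongrightarrow> F \<theta>" for \<theta>
    by (simp add: sums_def S_def)
  have [measurable]: "F \<in> borel_measurable borel"
    by (rule borel_measurable_LIMSEQ_metric[where f = S]) (auto simp: lim)
  have [measurable]: "S n \<in> borel_measurable M" "F \<in> borel_measurable M" for n
    by (simp_all add: measM)
  define B where "B = (\<Sum>k. cmod (a k))"
  have SB: "cmod (S n \<theta>) \<le> B" for n \<theta>
  proof -
    have "cmod (S n \<theta>) \<le> (\<Sum>k<n. cmod (a k))"
      unfolding S_def by (rule order_trans[OF norm_sum]) (simp add: norm_mult)
    also have "\<dots> \<le> B"
      unfolding B_def by (rule sum_le_suminf[OF a]) auto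
    finally show ?thesis .
  qed
  have FB: "cmod (F \<theta>) \<le> B" for \<theta>
    by (rule LIMSEQ_le_const2[OF tendsto_norm[OF lim]]) (use SB in auto)
  have "B \<ge> 0" using SB[of 0 0] by (simp add: S_def)
  have fin: "(LINT \<theta>|M. complex_of_real ((cmod (S n \<theta>))\<^sup>2)) = 2 * pi * (\<Sum>k<n. (cmod (a k))\<^sup>2)" for n
  proof -
    have eq: "complex_of_real ((cmod (S n \<theta>))\<^sup>2)
        = (\<Sum>j<n. \<Sum>k<n. a j * cnj (a k) * cis (of_int (int j - int k) * \<theta>))" for \<theta>
    proof -
      have "cis (of_nat j * \<theta>) * cnj (cis (of_nat k * \<theta>)) = cis (of_int (int j - int k) * \<theta>)" for j k
        by (simp add: cis_cnj cis_mult algebra_simps)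
      then show ?thesis
        unfolding complex_norm_square S_def cnj_sum sum_product
        by (intro sum.cong refl) (simp add: mult_ac)
    qed
    have int: "integrable M (\<lambda>\<theta>. cis (of_int m * \<theta>))" for m :: int
      by (rule M.integrable_const_bound[where B = 1])
        (auto intro!: measM borel_measurable_continuous_onI continuous_intros)
    have "(LINT \<theta>|M. complex_of_real ((cmod (S n \<theta>))\<^sup>2))
        = (\<Sum>j<n. \<Sum>k<n. a j * cnj (a k) * (if int j - int k = 0 then 2 * pi else 0))"
      unfolding eq using int
      by (simp add: integral_cis_period[folded M_def] del: of_int_diff of_int_of_nat_eq)
    also have "\<dots> = (\<Sum>j<n. (cmod (a j))\<^sup>2 * (2 * pi))"
      unfolding of_real_sum of_real_mult complex_norm_square
      by (simp add: if_distrib cong: if_cong)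
    finally show ?thesis by (simp add: sum_distrib_left mult_ac)
  qed
  have intS: "integrable M (\<lambda>\<theta>. (cmod (S n \<theta>))\<^sup>2)" for n
    by (rule M.integrable_const_bound[where B = "B\<^sup>2"])
      (use SB in \<open>auto intro!: AE_I2 power_mono\<close>)
  have intF: "integrable M (\<lambda>\<theta>. (cmod (F \<theta>))\<^sup>2)"
    by (rule M.integrable_const_bound[where B = "B\<^sup>2"])
      (use FB in \<open>auto intro!: AE_I2 power_mono\<close>)
  have "(\<lambda>n. LINT \<theta>|M. (cmod (S n \<theta>))\<^sup>2) \<longlonglongrightarrow> (LINT \<theta>|M. (cmod (F \<theta>))\<^sup>2)"
    by (rule integral_dominated_convergence[where w = "\<lambda>_. B\<^sup>2"])
      (use SB \<open>B \<ge> 0\<close> in \<open>auto intro!: AE_I2 power_mono tendsto_intros lim\<close>)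
  moreover have "(LINT \<theta>|M. (cmod (S n \<theta>))\<^sup>2) = 2 * pi * (\<Sum>k<n. (cmod (a k))\<^sup>2)" for n
  proof -
    have "complex_of_real (LINT \<theta>|M. (cmod (S n \<theta>))\<^sup>2) = of_real (2 * pi * (\<Sum>k<n. (cmod (a k))\<^sup>2))"
      using fin[of n] by (simp del: of_real_power)
    then show ?thesis by (simp only: of_real_eq_iff)
  qed
  ultimately have "(\<lambda>n. 2 * pi * (\<Sum>k<n. (cmod (a k))\<^sup>2)) \<longlonglongrightarrow> (LINT \<theta>|M. (cmod (F \<theta>))\<^sup>2)"
    by simp
  then have "(\<lambda>n. 2 * pi * (\<Sum>k<n. (cmod (a k))\<^sup>2) / (2 * pi)) \<longlonglongrightarrow> (LINT \<theta>|M. (cmod (F \<theta>))\<^sup>2) / (2 * pi)"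
    by (intro tendsto_intros) auto
  then have "(\<lambda>k. (cmod (a k))\<^sup>2) sums ((LINT \<theta>|M. (cmod (F \<theta>))\<^sup>2) / (2 * pi))"
    by (simp add: sums_def)
  then have "(\<Sum>k. ennreal ((cmod (a k))\<^sup>2)) = ennreal ((LINT \<theta>|M. (cmod (F \<theta>))\<^sup>2) / (2 * pi))"
    by (intro suminf_ennreal_eq) auto
  moreover have "(\<integral>\<^sup>+\<theta>. ennreal ((cmod (F \<theta>))\<^sup>2) \<partial>M) = ennreal (LINT \<theta>|M. (cmod (F \<theta>))\<^sup>2)"
    by (rule nn_integral_eq_integral[OF intF]) auto
  ultimately show ?thesis
    by (simp add: M_def[symmetric] F_def[symmetric] ennreal_mult'[symmetric])
qed

text \<open>All moments come at once from their exponential generating function: it is the integral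
  of \<open>exp (x * (cmod z)\<^sup>2)\<close> against the weight, again a Gaussian integral, with
  value \<open>1 / (1 - x / (pi * t))\<close>. This is a geometric series, and coefficients are
  compared.\<close>

lemma nn_integral_gaussian_moment:
  assumes t: "t > 0"
  shows "(\<integral>\<^sup>+z. ennreal ((cmod z) ^ (2 * k) * mu t z) \<partial>lborel) = ennreal (fact k / (pi * t) ^ k)"
proof -
  define m where "m k = (\<integral>\<^sup>+z. ennreal ((cmod z) ^ (2 * k) * mu t z) \<partial>lborel)" for k
  have [measurable]: "mu t \<in> borel_measurable borel"
    unfolding mu_def[abs_def] by measurable
  have mu0: "mu t z \<ge> 0" for z using t by (simp add: mu_def)
  have gen: "(\<Sum>k. ennreal (x ^ k / fact k) * m k) = ennreal (1 / (1 - x / (pi * t)))"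
    if x: "0 < x" "x < pi * t" for x
  proof -
    have "(\<Sum>k. ennreal (x ^ k / fact k) * m k)
        = (\<Sum>k. \<integral>\<^sup>+z. ennreal (x ^ k / fact k * ((cmod z) ^ (2 * k) * mu t z)) \<partial>lborel)"
      unfolding m_def using x
      by (subst nn_integral_cmult[symmetric]) (auto simp flip: ennreal_mult')
    also have "\<dots> = (\<integral>\<^sup>+z. (\<Sum>k. ennreal (x ^ k / fact k * ((cmod z) ^ (2 * k) * mu t z))) \<partial>lborel)"
      by (rule nn_integral_suminf[symmetric]) measurable
    also have "\<dots> = (\<integral>\<^sup>+z. ennreal t * ennreal (exp (- (pi * t - x) * (cmod z)\<^sup>2)) \<partial>lborel)"
    proof (rule nn_integral_cong)
      fix z
      have "(\<lambda>k. (x * (cmod z)\<^sup>2) ^ k /\<^sub>R fact k) sums exp (x * (cmod z)\<^sup>2)"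
        by (rule exp_converges)
      from sums_mult2[OF this, of "mu t z"]
      have "(\<lambda>k. x ^ k / fact k * ((cmod z) ^ (2 * k) * mu t z)) sums (exp (x * (cmod z)\<^sup>2) * mu t z)"
        unfolding power_mult[of "cmod z" 2] by (simp add: field_simps power_mult_distrib)
      then have "(\<Sum>k. ennreal (x ^ k / fact k * ((cmod z) ^ (2 * k) * mu t z)))
          = ennreal (exp (x * (cmod z)\<^sup>2) * mu t z)"
        using x by (intro suminf_ennreal_eq) (auto simp: mu0)
      also have "exp (x * (cmod z)\<^sup>2) * mu t z = t * exp (- (pi * t - x) * (cmod z)\<^sup>2)"
        by (simp add: mu_def exp_add[symmetric] algebra_simps)
      finally show "(\<Sum>k. ennreal (x ^ k / fact k * ((cmod z) ^ (2 * k) * mu t z)))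
          = ennreal t * ennreal (exp (- (pi * t - x) * (cmod z)\<^sup>2))"
        using t by (simp add: ennreal_mult')
    qed
    also have "\<dots> = ennreal t * ennreal (pi / (pi * t - x))"
      using x nn_integral_gaussian_complex[of "pi * t - x"] by (subst nn_integral_cmult) auto
    also have "\<dots> = ennreal (1 / (1 - x / (pi * t)))"
      using x t by (subst ennreal_mult'[symmetric]) (auto intro!: arg_cong[where f = ennreal] simp: field_simps)
    finally show ?thesis .
  qed
  \<comment> \<open>Comparing real coefficients requires finite moments; one term of a series with
    finite sum is finite.\<close>
  have fin: "m k < \<infinity>" for k
  proof -
    define x where "x = pi * t / 2"
    have x: "0 < x" "x < pi * t" using t by (auto simp: x_def)
    have "ennreal (x ^ k / fact k) * m k \<le> (\<Sum>k. ennreal (x ^ k / fact k) * m k)"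
      using sum_le_suminf[of "\<lambda>k. ennreal (x ^ k / fact k) * m k" "{k}"] by simp
    also have "\<dots> < \<infinity>" by (simp add: gen[OF x])
    finally have "ennreal (x ^ k / fact k) * m k < \<infinity>" .
    moreover have "x ^ k / fact k > 0" using x by simp
    ultimately show ?thesis
      using x by (auto simp: ennreal_mult_less_top)
  qed
  have mr: "m k = ennreal (enn2real (m k))" for k
    using fin[of k] by simp
  have "(\<lambda>k. enn2real (m k) / fact k) = (\<lambda>k. 1 / (pi * t) ^ k)"
  proof (rule powser_unique_at_right[of "pi * t"])
    show "0 < pi * t" using t by simp
    fix x assume x: "0 < x" "x < pi * t"
    have "(\<lambda>k. (x / (pi * t)) ^ k) sums (1 / (1 - x / (pi * t)))"
      by (rule geometric_sums) (use x t in auto)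
    then have 1: "(\<lambda>k. 1 / (pi * t) ^ k * x ^ k) sums (1 / (1 - x / (pi * t)))"
      by (simp add: power_divide)
    have *: "(\<Sum>k. ennreal (enn2real (m k) / fact k * x ^ k)) = ennreal (1 / (1 - x / (pi * t)))"
      unfolding gen[OF x, symmetric] using x
      by (intro suminf_cong, subst (2) mr) (auto simp: ennreal_mult'[symmetric] mult_ac)
    have sm: "summable (\<lambda>k. enn2real (m k) / fact k * x ^ k)"
      by (rule summable_suminf_not_top) (use x * in auto)
    then have "ennreal (\<Sum>k. enn2real (m k) / fact k * x ^ k) = ennreal (1 / (1 - x / (pi * t)))"
      unfolding *[symmetric] using x by (intro suminf_ennreal2[symmetric]) auto
    moreover have "(\<Sum>k. enn2real (m k) / fact k * x ^ k) \<ge> 0"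
      using x by (intro suminf_nonneg sm) auto
    ultimately have "(\<Sum>k. enn2real (m k) / fact k * x ^ k) = 1 / (1 - x / (pi * t))"
      using x t by (subst (asm) ennreal_inj) auto
    with sm have "(\<lambda>k. enn2real (m k) / fact k * x ^ k) sums (1 / (1 - x / (pi * t)))"
      by (simp add: sums_iff)
    with 1 show "(\<lambda>k. enn2real (m k) / fact k * x ^ k) sums (1 / (1 - x / (pi * t)))
      \<and> (\<lambda>k. 1 / (pi * t) ^ k * x ^ k) sums (1 / (1 - x / (pi * t)))" by simp
  qed
  then have "enn2real (m k) / fact k = 1 / (pi * t) ^ k"
    by (rule fun_cong)
  then have "enn2real (m k) = fact k / (pi * t) ^ k"
    by (simp add: field_simps)
  with mr[of k] show ?thesis by (simp add: m_def)
qed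

text \<open>The weight depends on \<open>cmod z\<close> only, so the integral equals its average
  over all rotations of \<open>F\<close>. Every integrand is nonnegative, hence Tonelli and termwise
  integration hold even if both sides are infinite. The formula can therefore both prove and exploit
  finiteness of the norm.\<close>

lemma nn_integral_entire_gaussian:
  assumes t: "t > 0" and F: "\<And>z. (\<lambda>k. a k * z ^ k) sums F z"
  shows "(\<integral>\<^sup>+z. ennreal ((cmod (F z))\<^sup>2 * mu t z) \<partial>lborel)
      = (\<Sum>k. ennreal ((cmod (a k))\<^sup>2 * (fact k / (pi * t) ^ k)))"
proof -
  define M where "M = restrict_space (lborel :: real measure) {0..2*pi}"
  have emM: "emeasure M (space M) = ennreal (2 * pi)"
    by (simp add: M_def emeasure_restrict_space space_restrict_space)
  interpret M: finite_measure M by standard (simp add: emM)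
  interpret P: pair_sigma_finite M "lborel :: complex measure" ..
  have [measurable]: "mu t \<in> borel_measurable borel"
    unfolding mu_def[abs_def] by measurable
  have mu0: "mu t z \<ge> 0" for z using t by (simp add: mu_def)
  have [measurable]: "F \<in> borel_measurable borel"
    by (rule borel_measurable_LIMSEQ_metric[where f = "\<lambda>n z. \<Sum>k<n. a k * z ^ k"])
      (use F in \<open>auto simp: sums_def\<close>)
  have [measurable]: "cis \<in> borel_measurable M"
    unfolding M_def by (intro measurable_restrict_space1)
      (auto intro!: borel_measurable_continuous_onI continuous_intros)
  have "ennreal (2 * pi) * (\<integral>\<^sup>+z. ennreal ((cmod (F z))\<^sup>2 * mu t z) \<partial>lborel)
      = (\<integral>\<^sup>+\<theta>. (\<integral>\<^sup>+z. ennreal ((cmod (F z))\<^sup>2 * mu t z) \<partial>lborel) \<partial>M)"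
    by (simp add: emM mult.commute)
  also have "\<dots> = (\<integral>\<^sup>+\<theta>. (\<integral>\<^sup>+z. ennreal ((cmod (F (cis \<theta> * z)))\<^sup>2 * mu t z) \<partial>lborel) \<partial>M)"
  proof (rule nn_integral_cong)
    fix \<theta> :: real
    show "(\<integral>\<^sup>+z. ennreal ((cmod (F z))\<^sup>2 * mu t z) \<partial>lborel)
        = (\<integral>\<^sup>+z. ennreal ((cmod (F (cis \<theta> * z)))\<^sup>2 * mu t z) \<partial>lborel)"
      by (subst nn_integral_complex_rotate[of _ "cis \<theta>", symmetric])
        (auto simp: mu_def norm_mult)
  qed
  also have "\<dots> = (\<integral>\<^sup>+z. (\<integral>\<^sup>+\<theta>. ennreal ((cmod (F (cis \<theta> * z)))\<^sup>2 * mu t z) \<partial>M) \<partial>lborel)"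
    by (rule P.Fubini'[symmetric]) measurable
  also have "\<dots> = (\<integral>\<^sup>+z. ennreal (mu t z) * (ennreal (2 * pi) * (\<Sum>k. ennreal ((cmod (a k * z ^ k))\<^sup>2))) \<partial>lborel)"
  proof (rule nn_integral_cong)
    fix z
    have "summable (\<lambda>k. cmod (a k * z ^ k))"
    proof -
      \<comment> \<open>Convergence at a point of larger modulus gives absolute convergence at
        \<open>z\<close>.\<close>
      have "summable (\<lambda>k. a k * of_real (cmod z + 1) ^ k)"
        using F sums_summable by blast
      then show ?thesis by (rule powser_insidea) (simp add: norm_of_real del: of_real_add)
    qed
    from nn_integral_trig_series[OF this, folded M_def]
    have "(\<integral>\<^sup>+\<theta>. ennreal ((cmod (\<Sum>k. a k * z ^ k * cis (of_nat k * \<theta>)))\<^sup>2) \<partial>M)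
        = ennreal (2 * pi) * (\<Sum>k. ennreal ((cmod (a k * z ^ k))\<^sup>2))" .
    moreover have "(\<Sum>k. a k * z ^ k * cis (of_nat k * \<theta>)) = F (cis \<theta> * z)" for \<theta>
      using F[of "cis \<theta> * z"] by (simp add: sums_iff power_mult_distrib Complex.DeMoivre mult_ac)
    ultimately show "(\<integral>\<^sup>+\<theta>. ennreal ((cmod (F (cis \<theta> * z)))\<^sup>2 * mu t z) \<partial>M)
        = ennreal (mu t z) * (ennreal (2 * pi) * (\<Sum>k. ennreal ((cmod (a k * z ^ k))\<^sup>2)))"
      using mu0[of z] by (simp add: ennreal_mult nn_integral_cmult mult.commute[of _ "ennreal (mu t z)"])
  qed
  also have "\<dots> = (\<integral>\<^sup>+z. ennreal (2 * pi) * (\<Sum>k. ennreal ((cmod (a k))\<^sup>2) * ennreal ((cmod z) ^ (2 * k) * mu t z)) \<partial>lborel)"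
  proof (rule nn_integral_cong)
    fix z
    have "(\<Sum>k. ennreal ((cmod (a k))\<^sup>2) * ennreal ((cmod z) ^ (2 * k) * mu t z))
        = (\<Sum>k. ennreal (mu t z) * ennreal ((cmod (a k * z ^ k))\<^sup>2))"
    proof (rule suminf_cong)
      fix k
      have "(cmod (a k))\<^sup>2 * ((cmod z) ^ (2 * k) * mu t z) = mu t z * (cmod (a k * z ^ k))\<^sup>2"
        by (simp add: norm_mult norm_power power_mult_distrib power_even_eq)
      then show "ennreal ((cmod (a k))\<^sup>2) * ennreal ((cmod z) ^ (2 * k) * mu t z)
          = ennreal (mu t z) * ennreal ((cmod (a k * z ^ k))\<^sup>2)"
        by (simp add: mu0 flip: ennreal_mult')
    qed
    then show "ennreal (mu t z) * (ennreal (2 * pi) * (\<Sum>k. ennreal ((cmod (a k * z ^ k))\<^sup>2)))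
        = ennreal (2 * pi) * (\<Sum>k. ennreal ((cmod (a k))\<^sup>2) * ennreal ((cmod z) ^ (2 * k) * mu t z))"
      by (simp add: ennreal_suminf_cmult mult_ac)
  qed
  also have "\<dots> = ennreal (2 * pi) * (\<Sum>k. ennreal ((cmod (a k))\<^sup>2) * ennreal (fact k / (pi * t) ^ k))"
    by (simp add: nn_integral_cmult nn_integral_suminf nn_integral_gaussian_moment[OF t])
  also have "(\<lambda>k. ennreal ((cmod (a k))\<^sup>2) * ennreal (fact k / (pi * t) ^ k))
      = (\<lambda>k. ennreal ((cmod (a k))\<^sup>2 * (fact k / (pi * t) ^ k)))"
    by (simp add: ennreal_mult'[symmetric])
  finally show ?thesis
    by (subst (asm) ennreal_mult_cancel_left) auto
qed

subsection \<open>The Bargmann kernel and Gaussian bounds for Hermite functions\<close>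

lemma powser_unique_at_right_complex:
  fixes c d :: "nat \<Rightarrow> complex"
  assumes "r > 0"
    and eq: "\<And>x. 0 < x \<Longrightarrow> x < r \<Longrightarrow>
      (\<lambda>n. c n * of_real x ^ n) sums f x \<and> (\<lambda>n. d n * of_real x ^ n) sums f x"
  shows "c = d"
proof -
  have "(\<lambda>n. Re (c n)) = (\<lambda>n. Re (d n))"
    by (rule powser_unique_at_right[OF \<open>r > 0\<close>, of _ "\<lambda>x. Re (f x)"])
      (use eq in \<open>force dest!: sums_Re simp flip: of_real_power\<close>)
  moreover have "(\<lambda>n. Im (c n)) = (\<lambda>n. Im (d n))"
    by (rule powser_unique_at_right[OF \<open>r > 0\<close>, of _ "\<lambda>x. Im (f x)"])
      (use eq in \<open>force dest!: sums_Im simp flip: of_real_power\<close>)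
  ultimately show ?thesis
    by (simp add: fun_eq_iff complex_eq_iff)
qed

text \<open>This is \<open>A\<close> of the overview, the kernel of the Segal-Bargmann transform
  onto \<open>HL2 1\<close>, which is the case \<open>s = 1\<close>. At \<open>z = 0\<close> it is
  \<open>hermite0\<close>, which fixes the factor in front.\<close>

definition bargmann_kernel :: "complex \<Rightarrow> real \<Rightarrow> complex" where
  "bargmann_kernel z x = of_real (2 powr (1/4)) *
     exp (- of_real pi * (of_real x)\<^sup>2 + 2 * of_real pi * of_real x * z - of_real pi * z\<^sup>2 / 2)"

text \<open>\<open>Z_star f = - exp (pi x\<^sup>2) (exp (- pi x\<^sup>2) f)' / (2 pi)\<close>, which gives a Rodrigues formula
  for its iterates.\<close>

lemma Z_star_funpow_hermite0:
  defines "E \<equiv> \<lambda>w::complex. exp (- 2 * of_real pi * w\<^sup>2)"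
  shows "complex_of_real ((Z_star ^^ k) hermite0 x) = (- 1 / (2 * of_real pi)) ^ k *
    (of_real (2 powr (1/4)) * exp (of_real pi * (of_real x)\<^sup>2) * (deriv ^^ k) E (of_real x))"
proof (induction k arbitrary: x)
  case 0
  show ?case
    by (simp add: E_def hermite0_def exp_of_real[symmetric] exp_add[symmetric] algebra_simps)
next
  case (Suc k)
  define g where "g = (Z_star ^^ k) hermite0"
  define b :: complex where "b = (- 1 / (2 * of_real pi)) ^ k * of_real (2 powr (1/4))"
  define G where "G w = b * (exp (of_real pi * w\<^sup>2) * (deriv ^^ k) E w)" for w
  have g: "complex_of_real (g x) = G (of_real x)" for x
    using Suc[of x] by (simp add: g_def G_def b_def)
  have "E holomorphic_on UNIV"
    unfolding E_def by (intro holomorphic_intros)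
  then have "(deriv ^^ k) E holomorphic_on UNIV"
    by (rule holomorphic_higher_deriv) simp
  then have dE: "((deriv ^^ k) E has_field_derivative (deriv ^^ Suc k) E w) (at w)" for w
    by (simp add: holomorphic_derivI)
  define D where "D = 2 * of_real pi * of_real x * G (of_real x)
    + b * (exp (of_real pi * (of_real x)\<^sup>2) * (deriv ^^ Suc k) E (of_real x))"
  have "(G has_field_derivative D) (at (of_real x))"
    unfolding G_def[abs_def] D_def
    by (rule derivative_eq_intros dE refl | simp)+ (simp add: algebra_simps G_def)
  from has_vector_derivative_real_field[OF this]
  have "((\<lambda>x. complex_of_real (g x)) has_vector_derivative D) (at x)"
    by (simp add: g)
  \<comment> \<open>\<open>g\<close> is real, so the imaginary part of \<open>D\<close> is the
    derivative of 0; this turns the derivative along the real axis into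
    \<open>deriv g x\<close>.\<close>
  from has_field_derivative_Re[OF this] has_field_derivative_Im[OF this]
  have "(g has_field_derivative Re D) (at x)" "((\<lambda>x. 0) has_field_derivative Im D) (at x)"
    by simp_all
  moreover from this(2) have "Im D = 0"
    by (rule DERIV_unique) simp
  ultimately have "complex_of_real (deriv g x) = D"
    by (simp add: DERIV_imp_deriv complex_eq_iff)
  then have "complex_of_real (Z_star g x) = of_real x * G (of_real x) - 1 / (2 * of_real pi) * D"
    by (simp add: Z_star_def g)
  also have "\<dots> = (- 1 / (2 * of_real pi)) * (b * (exp (of_real pi * (of_real x)\<^sup>2) * (deriv ^^ Suc k) E (of_real x)))"
    by (simp add: D_def field_simps)
  finally show ?case
    by (simp add: g_def[symmetric] b_def)
qed

text \<open>By the Rodrigues formula the terms are those of the Taylor series of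
  \<open>exp (- 2 * pi * w\<^sup>2)\<close> about \<open>x\<close>, taken at
  \<open>x - z / 2\<close>: the powers of \<open>pi\<close> and of \<open>- 1 / (2 * pi)\<close>
  combine to powers of \<open>- 1 / 2\<close>.\<close>

lemma hermite_generating_function:
  "(\<lambda>k. of_real (hermite k x * sqrt (pi ^ k / fact k)) * z ^ k) sums bargmann_kernel z x"
proof -
  define E where "E = (\<lambda>w::complex. exp (- 2 * of_real pi * w\<^sup>2))"
  define B where "B = of_real (2 powr (1/4)) * exp (complex_of_real pi * (of_real x)\<^sup>2)"
  have hol: "E holomorphic_on ball (of_real x) (cmod z + 1)"
    unfolding E_def by (intro holomorphic_intros)
  have "(\<lambda>k. (deriv ^^ k) E (of_real x) / fact k * (of_real x - z / 2 - of_real x) ^ k)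
      sums E (of_real x - z / 2)"
    by (rule holomorphic_power_series[OF hol]) (auto simp: dist_norm norm_divide intro: add_nonneg_pos)
  from sums_mult[OF this, of B]
  have "(\<lambda>k. B * ((deriv ^^ k) E (of_real x) / fact k * (- z / 2) ^ k)) sums (B * E (of_real x - z / 2))"
    by simp
  also have "(\<lambda>k. B * ((deriv ^^ k) E (of_real x) / fact k * (- z / 2) ^ k))
      = (\<lambda>k. of_real (hermite k x * sqrt (pi ^ k / fact k)) * z ^ k)"
  proof
    fix k
    have "hermite k x * sqrt (pi ^ k / fact k) = pi ^ k / fact k * (Z_star ^^ k) hermite0 x"
      by (simp add: hermite_def mult_ac)
    then have "of_real (hermite k x * sqrt (pi ^ k / fact k)) * z ^ k
        = of_real pi ^ k / fact k * z ^ k * ((- 1 / (2 * of_real pi)) ^ k * (B * (deriv ^^ k) E (of_real x)))"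
      using Z_star_funpow_hermite0[of k x] by (simp add: E_def B_def)
    also have "\<dots> = (of_real pi * z * (- 1 / (2 * of_real pi))) ^ k * (B * (deriv ^^ k) E (of_real x)) / fact k"
      unfolding power_mult_distrib by simp
    also have "of_real pi * z * (- 1 / (2 * of_real pi)) = - z / 2"
      by simp
    finally show "B * ((deriv ^^ k) E (of_real x) / fact k * (- z / 2) ^ k)
        = of_real (hermite k x * sqrt (pi ^ k / fact k)) * z ^ k" by simp
  qed
  also have "B * E (of_real x - z / 2) = bargmann_kernel z x"
  proof -
    have "of_real pi * (of_real x)\<^sup>2 + - 2 * of_real pi * (of_real x - z / 2)\<^sup>2
        = - of_real pi * (of_real x)\<^sup>2 + 2 * of_real pi * of_real x * z - of_real pi * z\<^sup>2 / 2"
      by (simp add: power2_eq_square algebra_simps)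
    moreover have "B * E (of_real x - z / 2) = of_real (2 powr (1/4)) *
        exp (of_real pi * (of_real x)\<^sup>2 + - 2 * of_real pi * (of_real x - z / 2)\<^sup>2)"
      by (simp only: B_def E_def exp_add mult.assoc)
    ultimately show ?thesis
      by (simp only: bargmann_kernel_def)
  qed
  finally show ?thesis .
qed

lemma continuous_on_hermite[continuous_intros]: "continuous_on S (hermite k)"
proof -
  define E where "E = (\<lambda>w::complex. exp (- 2 * of_real pi * w\<^sup>2))"
  have "E holomorphic_on UNIV"
    unfolding E_def by (intro holomorphic_intros)
  then have "(deriv ^^ k) E holomorphic_on UNIV"
    by (rule holomorphic_higher_deriv) simp
  then have "continuous_on UNIV ((deriv ^^ k) E)"
    by (rule holomorphic_on_imp_continuous_on)
  then have cE: "continuous_on UNIV (\<lambda>x. (deriv ^^ k) E (complex_of_real x))"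
    by (rule continuous_on_compose2) (auto intro: continuous_intros)
  have "hermite k x = Re (of_real (sqrt (pi ^ k / fact k)) * ((- 1 / (2 * of_real pi)) ^ k *
    (of_real (2 powr (1/4)) * exp (of_real pi * (of_real x)\<^sup>2) * (deriv ^^ k) E (of_real x))))" for x
    using Z_star_funpow_hermite0[of k x, folded E_def, symmetric] by (simp add: hermite_def)
  moreover have "continuous_on UNIV (\<lambda>x. Re (of_real (sqrt (pi ^ k / fact k)) * ((- 1 / (2 * of_real pi)) ^ k *
    (of_real (2 powr (1/4)) * exp (of_real pi * (of_real x)\<^sup>2) * (deriv ^^ k) E (of_real x)))))"
    by (intro continuous_intros cE)
  ultimately have "continuous_on UNIV (hermite k)"
    by (simp add: fun_eq_iff cong: continuous_on_cong)
  then show ?thesis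
    by (rule continuous_on_subset) simp
qed

lemma borel_measurable_hermite[measurable]: "hermite k \<in> borel_measurable borel"
  by (intro borel_measurable_continuous_onI continuous_intros)

lemma borel_measurable_bargmann_kernel[measurable]: "bargmann_kernel z \<in> borel_measurable borel"
  unfolding bargmann_kernel_def[abs_def] by measurable

text \<open>Maximizing the exponent over \<open>x\<close> gives exactly
  \<open>pi * (cmod z)\<^sup>2 / 2\<close>, with no decay left in \<open>x\<close>. Allowing
  \<open>\<epsilon>\<close> more growth in \<open>z\<close> buys the Gaussian factor in
  \<open>x\<close>; the square completed is that of \<open>x - (1 + \<epsilon>) * u\<close>.\<close>

lemma norm_bargmann_kernel_le:
  assumes "\<epsilon> > 0"
  shows "cmod (bargmann_kernel z x)
    \<le> 2 powr (1/4) * exp (pi * (- (\<epsilon> / (1 + \<epsilon>)) * x\<^sup>2 + (1/2 + \<epsilon>) * (cmod z)\<^sup>2))"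
proof -
  define u where "u = Re z"
  define v where "v = Im z"
  have "0 \<le> (x - (1 + \<epsilon>) * u)\<^sup>2 / (1 + \<epsilon>)"
    using assms by simp
  also have "\<dots> = x\<^sup>2 / (1 + \<epsilon>) - 2 * x * u + (1 + \<epsilon>) * u\<^sup>2"
    using assms by (simp add: power2_eq_square field_simps)
  also have "x\<^sup>2 / (1 + \<epsilon>) = x\<^sup>2 - \<epsilon> / (1 + \<epsilon>) * x\<^sup>2"
    using assms by (simp add: field_simps)
  finally have "- x\<^sup>2 + 2 * x * u - (u\<^sup>2 - v\<^sup>2) / 2
      \<le> - (\<epsilon> / (1 + \<epsilon>)) * x\<^sup>2 + (1/2 + \<epsilon>) * u\<^sup>2 + v\<^sup>2 / 2"
    by (simp add: algebra_simps diff_divide_distrib)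
  also have "\<dots> \<le> - (\<epsilon> / (1 + \<epsilon>)) * x\<^sup>2 + (1/2 + \<epsilon>) * (cmod z)\<^sup>2"
    using assms by (simp add: cmod_power2 u_def v_def algebra_simps)
  finally have "pi * (- x\<^sup>2 + 2 * x * u - (u\<^sup>2 - v\<^sup>2) / 2)
      \<le> pi * (- (\<epsilon> / (1 + \<epsilon>)) * x\<^sup>2 + (1/2 + \<epsilon>) * (cmod z)\<^sup>2)"
    by (intro mult_left_mono) auto
  moreover have "Re (- of_real pi * (of_real x)\<^sup>2 + 2 * of_real pi * of_real x * z - of_real pi * z\<^sup>2 / 2)
      = pi * (- x\<^sup>2 + 2 * x * u - (u\<^sup>2 - v\<^sup>2) / 2)"
    by (simp add: u_def v_def power2_eq_square algebra_simps)
  ultimately show ?thesis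
    by (simp add: bargmann_kernel_def norm_mult)
qed

text \<open>For fixed \<open>x\<close>, the square of \<open>\<bar>hermite k x\<bar> * r ^ k\<close>
  is the \<open>k\<close>-th term of the Gaussian norm formula with \<open>t = 1\<close> for the
  function sending \<open>z\<close> to \<open>bargmann_kernel (r * z) x\<close>. The pointwise
  kernel bound estimates the whole norm, and \<open>r < 1\<close> leaves room for a positive
  \<open>\<epsilon>\<close>.\<close>

lemma hermite_gaussian_bound:
  assumes r: "0 < r" "r < 1"
  obtains C d where "C > 0" "d > 0" "\<And>k x. \<bar>hermite k x\<bar> * r ^ k \<le> C * exp (- d * x\<^sup>2)"
proof -
  \<comment> \<open>Chosen so that \<open>(1 + 2 * \<epsilon>) * r\<^sup>2\<close> lies halfway
    between \<open>r\<^sup>2\<close> and 1; the squared kernel then stays integrable against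
    \<open>mu 1\<close>.\<close>
  define \<epsilon> where "\<epsilon> = (1 / r\<^sup>2 - 1) / 4"
  have r2: "0 < r\<^sup>2" "r\<^sup>2 < 1"
    using r by (auto simp: power_less_one_iff)
  have \<epsilon>: "\<epsilon> > 0" using r2 by (simp add: \<epsilon>_def field_simps)
  have er: "(1 + 2 * \<epsilon>) * r\<^sup>2 = (r\<^sup>2 + 1) / 2"
    using r by (simp add: \<epsilon>_def field_simps)
  define d where "d = pi * (\<epsilon> / (1 + \<epsilon>))"
  \<comment> \<open>\<open>sqrt 2\<close> is the squared constant of the kernel, and
    \<open>2 / (1 - r\<^sup>2)\<close> is the Gaussian integral that remains over
    \<open>z\<close>.\<close>
  define C where "C = sqrt (sqrt 2 * (2 / (1 - r\<^sup>2)))"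
  have sq: "(2 powr (1/4))\<^sup>2 = sqrt 2"
    by (simp add: powr_power powr_half_sqrt)
  have bound: "(\<bar>hermite k x\<bar> * r ^ k)\<^sup>2 \<le> (C * exp (- d * x\<^sup>2))\<^sup>2" for k x
  proof -
    define a where "a j = complex_of_real (hermite j x * sqrt (pi ^ j / fact j)) * of_real r ^ j" for j
    have sF: "(\<lambda>j. a j * z ^ j) sums bargmann_kernel (of_real r * z) x" for z
      using hermite_generating_function[of x "of_real r * z"]
      by (simp add: a_def power_mult_distrib mult_ac)
    have ak: "(cmod (a j))\<^sup>2 * (fact j / (pi * 1) ^ j) = (\<bar>hermite j x\<bar> * r ^ j)\<^sup>2" for j
      using r by (simp add: a_def norm_mult norm_power power_mult_distrib field_simps)
    have "ennreal ((\<bar>hermite k x\<bar> * r ^ k)\<^sup>2) \<le> (\<Sum>j. ennreal ((cmod (a j))\<^sup>2 * (fact j / (pi * 1) ^ j)))"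
      unfolding ak using sum_le_suminf[OF summableI, of "{k}" "\<lambda>j. ennreal ((\<bar>hermite j x\<bar> * r ^ j)\<^sup>2)"]
      by (simp only: sum.insert finite.intros empty_iff sum.empty add_0_right not_False_eq_True zero_le simp_thms)
    also have "\<dots> = (\<integral>\<^sup>+z. ennreal ((cmod (bargmann_kernel (of_real r * z) x))\<^sup>2 * mu 1 z) \<partial>lborel)"
      by (rule nn_integral_entire_gaussian[symmetric]) (use sF in auto)
    also have "\<dots> \<le> (\<integral>\<^sup>+z. ennreal (sqrt 2 * exp (- 2 * d * x\<^sup>2)) *
        ennreal (exp (- (pi * (1 - r\<^sup>2) / 2) * (cmod z)\<^sup>2)) \<partial>lborel)"
    proof (rule nn_integral_mono)
      fix z
      have "(cmod (bargmann_kernel (of_real r * z) x))\<^sup>2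
          \<le> (2 powr (1/4) * exp (pi * (- (\<epsilon> / (1 + \<epsilon>)) * x\<^sup>2 + (1/2 + \<epsilon>) * (cmod (of_real r * z))\<^sup>2)))\<^sup>2"
        by (intro power_mono norm_bargmann_kernel_le \<epsilon>) auto
      also have "\<dots> = sqrt 2 * exp (2 * (pi * (- (\<epsilon> / (1 + \<epsilon>)) * x\<^sup>2 + (1/2 + \<epsilon>) * (r\<^sup>2 * (cmod z)\<^sup>2))))"
        using r by (simp only: power_mult_distrib sq exp_double norm_mult) (simp add: power_mult_distrib)
      finally have "(cmod (bargmann_kernel (of_real r * z) x))\<^sup>2 * mu 1 z
        \<le> sqrt 2 * exp (2 * (pi * (- (\<epsilon> / (1 + \<epsilon>)) * x\<^sup>2 + (1/2 + \<epsilon>) * (r\<^sup>2 * (cmod z)\<^sup>2)))) * mu 1 z"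
        by (intro mult_right_mono) (auto simp: mu_def)
      also have "\<dots> = sqrt 2 * exp (- 2 * d * x\<^sup>2 + pi * (((1 + 2 * \<epsilon>) * r\<^sup>2) * (cmod z)\<^sup>2) - pi * (cmod z)\<^sup>2)"
        by (simp add: mu_def d_def algebra_simps flip: exp_add)
      also have "\<dots> = sqrt 2 * exp (- 2 * d * x\<^sup>2) * exp (- (pi * (1 - r\<^sup>2) / 2) * (cmod z)\<^sup>2)"
        unfolding er by (simp add: field_simps flip: exp_add)
      finally show "ennreal ((cmod (bargmann_kernel (of_real r * z) x))\<^sup>2 * mu 1 z)
          \<le> ennreal (sqrt 2 * exp (- 2 * d * x\<^sup>2)) * ennreal (exp (- (pi * (1 - r\<^sup>2) / 2) * (cmod z)\<^sup>2))"
        by (subst ennreal_mult'[symmetric]) (auto intro: ennreal_leI)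
    qed
    also have "\<dots> = ennreal (sqrt 2 * exp (- 2 * d * x\<^sup>2)) * ennreal (pi / (pi * (1 - r\<^sup>2) / 2))"
      using r2 nn_integral_gaussian_complex[of "pi * (1 - r\<^sup>2) / 2"] by (subst nn_integral_cmult) auto
    also have "\<dots> = ennreal (sqrt 2 * exp (- 2 * d * x\<^sup>2) * (2 / (1 - r\<^sup>2)))"
      by (subst ennreal_mult'[symmetric]) auto
    also have "sqrt 2 * exp (- 2 * d * x\<^sup>2) * (2 / (1 - r\<^sup>2)) = (C * exp (- d * x\<^sup>2))\<^sup>2"
      using r2 by (simp add: C_def power_mult_distrib flip: exp_double)
    finally show ?thesis
      by (subst (asm) ennreal_le_iff) auto
  qed
  have "C > 0" using r2 by (auto simp: C_def)
  show ?thesis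
  proof (rule that)
    show "C > 0" by fact
    show "d > 0" using \<epsilon> by (simp add: d_def)
    show "\<bar>hermite k x\<bar> * r ^ k \<le> C * exp (- d * x\<^sup>2)" for k x
      using power2_le_imp_le[OF bound] \<open>C > 0\<close> by simp
  qed
qed

section \<open>Closure properties of square-integrable functions\<close>

lemma sq_integrable_dominated:
  assumes "sq_integrable g" "f \<in> borel_measurable borel" "\<And>x. cmod (f x) \<le> cmod (g x)"
  shows "sq_integrable f"
proof -
  have [measurable]: "f \<in> borel_measurable borel" by fact
  show ?thesis
    unfolding sq_integrable_def
    using assms(1) assms(3)
    by (auto intro!: Bochner_Integration.integrable_bound[of lborel "\<lambda>x. (cmod (g x))\<^sup>2"] AE_I2 power_mono
        simp: sq_integrable_def)
qed

lemma integrable_mult_sq_integrable: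
  assumes f: "sq_integrable f" and g: "sq_integrable g"
  shows "integrable lborel (\<lambda>x. f x * g x)"
proof (rule Bochner_Integration.integrable_bound)
  show "integrable lborel (\<lambda>x. (cmod (f x))\<^sup>2 + (cmod (g x))\<^sup>2)"
    using f g by (auto simp: sq_integrable_def)
  show "(\<lambda>x. f x * g x) \<in> borel_measurable lborel"
    using f g by (auto simp: sq_integrable_def)
  have "cmod (f x) * cmod (g x) \<le> (cmod (f x))\<^sup>2 + (cmod (g x))\<^sup>2" for x
    using sum_squares_bound[of "cmod (f x)" "cmod (g x)"]
      mult_nonneg_nonneg[OF norm_ge_zero[of "f x"] norm_ge_zero[of "g x"]] by linarith
  then show "AE x in lborel. norm (f x * g x) \<le> norm ((cmod (f x))\<^sup>2 + (cmod (g x))\<^sup>2)"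
    by (auto simp: norm_mult)
qed

lemma sq_integrable_scale: "sq_integrable f \<Longrightarrow> sq_integrable (\<lambda>x. a * f x)"
  by (auto simp: sq_integrable_def norm_mult power_mult_distrib)

lemma sq_integrable_cnj: "sq_integrable f \<Longrightarrow> sq_integrable (\<lambda>x. cnj (f x))"
  by (auto simp: sq_integrable_def intro: borel_measurable_continuous_on[OF continuous_on_cnj[OF continuous_on_id]])

lemma sq_integrable_add:
  assumes f: "sq_integrable f" and g: "sq_integrable g"
  shows "sq_integrable (\<lambda>x. f x + g x)"
proof -
  have [measurable]: "f \<in> borel_measurable borel" "g \<in> borel_measurable borel"
    using f g by (auto simp: sq_integrable_def)
  have "integrable lborel (\<lambda>x. 2 * (cmod (f x))\<^sup>2 + 2 * (cmod (g x))\<^sup>2)"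
    using f g by (auto simp: sq_integrable_def)
  moreover have "(cmod (f x + g x))\<^sup>2 \<le> 2 * (cmod (f x))\<^sup>2 + 2 * (cmod (g x))\<^sup>2" for x
  proof -
    have "(cmod (f x + g x))\<^sup>2 \<le> (cmod (f x) + cmod (g x))\<^sup>2"
      by (intro power_mono norm_triangle_ineq) auto
    also have "\<dots> \<le> 2 * (cmod (f x))\<^sup>2 + 2 * (cmod (g x))\<^sup>2"
      using sum_squares_bound[of "cmod (f x)" "cmod (g x)"] by (simp add: power2_sum)
    finally show ?thesis .
  qed
  ultimately show ?thesis
    unfolding sq_integrable_def
    by (auto intro: Bochner_Integration.integrable_bound)
qed

lemma sq_integrable_diff:
  "sq_integrable f \<Longrightarrow> sq_integrable g \<Longrightarrow> sq_integrable (\<lambda>x. f x - g x)"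
  using sq_integrable_add[of f "\<lambda>x. - 1 * g x"] sq_integrable_scale[of g "- 1"] by simp

lemma sq_integrable_zero: "sq_integrable (\<lambda>_. 0)"
  by (simp add: sq_integrable_def)

lemma sq_integrable_sum: "(\<And>i. i \<in> I \<Longrightarrow> sq_integrable (f i)) \<Longrightarrow> sq_integrable (\<lambda>x. \<Sum>i\<in>I. f i x)"
  by (induction I rule: infinite_finite_induct) (auto intro: sq_integrable_add sq_integrable_zero)

lemma sq_integrable_gaussian:
  assumes "d > 0"
  shows "sq_integrable (\<lambda>x. of_real (C * exp (- d * x\<^sup>2)))"
proof -
  have e: "(cmod (of_real (C * exp (- d * x\<^sup>2))))\<^sup>2 = C\<^sup>2 * exp (- (2 * d) * x\<^sup>2)" for x
    by (simp add: norm_mult power_mult_distrib flip: exp_double)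
  have "integrable lborel (\<lambda>x. exp (- (2 * d) * x\<^sup>2))"
    by (rule integrableI_nonneg) (use assms nn_integral_gaussian_real[of "2 * d"] in auto)
  then show ?thesis
    unfolding sq_integrable_def e by simp
qed

lemma sq_integrable_hermite: "sq_integrable (\<lambda>x. of_real (hermite k x))"
proof -
  obtain C d where C: "C > 0" "d > 0" "\<And>k x. \<bar>hermite k x\<bar> * (1/2) ^ k \<le> C * exp (- d * x\<^sup>2)"
    using hermite_gaussian_bound[of "1/2"] by auto
  show ?thesis
  proof (rule sq_integrable_dominated)
    show "sq_integrable (\<lambda>x. of_real (C * 2 ^ k * exp (- d * x\<^sup>2)))"
      by (rule sq_integrable_gaussian) fact
    show "cmod (of_real (hermite k x)) \<le> cmod (of_real (C * 2 ^ k * exp (- d * x\<^sup>2)))" for x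
      using C(1) C(3)[of k x] by (simp add: norm_mult norm_power field_simps)
  qed measurable
qed

lemma sq_integrable_bargmann_kernel: "sq_integrable (bargmann_kernel z)"
proof (rule sq_integrable_dominated)
  define D where "D = 2 powr (1/4) * exp (pi * ((1/2 + 1) * (cmod z)\<^sup>2))"
  show "sq_integrable (\<lambda>x. of_real (D * exp (- (pi / 2) * x\<^sup>2)))"
    by (rule sq_integrable_gaussian) simp
  show "cmod (bargmann_kernel z x) \<le> cmod (of_real (D * exp (- (pi / 2) * x\<^sup>2)))" for x
  proof -
    have "D \<ge> 0" by (simp add: D_def)
    moreover have "2 powr (1/4) * exp (pi * (- (1 / (1 + 1)) * x\<^sup>2 + (1/2 + 1) * (cmod z)\<^sup>2)) = D * exp (- (pi / 2) * x\<^sup>2)"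
      by (simp add: D_def algebra_simps flip: exp_add)
    ultimately show ?thesis
      using norm_bargmann_kernel_le[of 1 z x] by (simp add: norm_mult)
  qed
qed measurable

subsection \<open>Hermite coefficients and the Bargmann transform\<close>

text \<open>The inner product with a Hermite function; these are real, so no conjugate
  appears.\<close>

definition hermite_coeff :: "(real \<Rightarrow> complex) \<Rightarrow> nat \<Rightarrow> complex" where
  "hermite_coeff f k = (LINT x|lborel. of_real (hermite k x) * f x)"

definition bargmann :: "(real \<Rightarrow> complex) \<Rightarrow> complex \<Rightarrow> complex" where
  "bargmann f z = (LINT x|lborel. bargmann_kernel z x * f x)"

definition L2_norm_sq :: "(real \<Rightarrow> complex) \<Rightarrow> real" where
  "L2_norm_sq f = (LINT x|lborel. (cmod (f x))\<^sup>2)"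

text \<open>Weights that stay summable after division by \<open>r ^ k\<close> can pay for the growth
  allowed to \<open>hermite k x\<close>; the common Gaussian then factors out of the sum.\<close>

lemma hermite_series_gaussian_bound:
  assumes r: "0 < r" "r < 1" and w: "summable (\<lambda>k. cmod (w k) / r ^ k)"
  obtains C d where "C > 0" "d > 0"
    "\<And>x. summable (\<lambda>k. cmod (w k * of_real (hermite k x)))"
    "\<And>x. cmod (\<Sum>k. w k * of_real (hermite k x)) \<le> C * exp (- d * x\<^sup>2)"
proof -
  obtain C d where C: "C > 0" "d > 0" "\<And>k x. \<bar>hermite k x\<bar> * r ^ k \<le> C * exp (- d * x\<^sup>2)"
    using hermite_gaussian_bound[OF r] by blast
  define W where "W = (\<Sum>k. cmod (w k) / r ^ k)"
  have W: "W \<ge> 0" unfolding W_def using r by (intro suminf_nonneg w) auto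
  have le: "cmod (w k * of_real (hermite k x)) \<le> cmod (w k) / r ^ k * (C * exp (- d * x\<^sup>2))" for k x
  proof -
    have "cmod (w k * of_real (hermite k x)) = cmod (w k) / r ^ k * (\<bar>hermite k x\<bar> * r ^ k)"
      using r by (simp add: norm_mult)
    also have "\<dots> \<le> cmod (w k) / r ^ k * (C * exp (- d * x\<^sup>2))"
      using r C(3)[of k x] by (intro mult_left_mono) auto
    finally show ?thesis .
  qed
  have sm: "summable (\<lambda>k. cmod (w k) / r ^ k * (C * exp (- d * x\<^sup>2)))" for x
    by (intro summable_mult2 w)
  have sn: "summable (\<lambda>k. cmod (w k * of_real (hermite k x)))" for x
    by (rule summable_comparison_test'[OF sm[of x]]) (use le in auto)
  show thesis
  proof (rule that)
    \<comment> \<open>\<open>W + 1\<close> keeps the constant positive even when all weights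
      vanish.\<close>
    show "0 < C * (W + 1)" "0 < d" using C W by auto
    show "summable (\<lambda>k. cmod (w k * of_real (hermite k x)))" for x by (rule sn)
    fix x
    have "cmod (\<Sum>k. w k * of_real (hermite k x)) \<le> (\<Sum>k. cmod (w k * of_real (hermite k x)))"
      by (rule summable_norm[OF sn])
    also have "\<dots> \<le> (\<Sum>k. cmod (w k) / r ^ k * (C * exp (- d * x\<^sup>2)))"
      by (rule suminf_le[OF _ sn sm]) (rule le)
    also have "\<dots> = W * (C * exp (- d * x\<^sup>2))"
      unfolding W_def by (rule suminf_mult2[symmetric, OF w])
    also have "\<dots> \<le> C * (W + 1) * exp (- d * x\<^sup>2)"
      using C by (simp add: algebra_simps)
    finally show "cmod (\<Sum>k. w k * of_real (hermite k x)) \<le> C * (W + 1) * exp (- d * x\<^sup>2)" .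
  qed
qed

text \<open>The tool for exchanging sum and integral: the integrals of the absolute terms are at
  most \<open>cmod (w k) / r ^ k\<close> times one fixed integral. It serves the Bargmann kernel,
  the Kac kernel and the functions in the range of the Kac operator.\<close>

lemma hermite_series_pairing:
  assumes r: "0 < r" "r < 1" and w: "summable (\<lambda>k. cmod (w k) / r ^ k)" and f: "sq_integrable f"
  shows "(\<lambda>k. w k * hermite_coeff f k) sums (LINT x|lborel. (\<Sum>k. w k * of_real (hermite k x)) * f x)"
proof -
  have [measurable]: "f \<in> borel_measurable borel" using f by (simp add: sq_integrable_def)
  obtain C d where C: "C > 0" "d > 0" "\<And>k x. \<bar>hermite k x\<bar> * r ^ k \<le> C * exp (- d * x\<^sup>2)"
    using hermite_gaussian_bound[OF r] by blast
  have sn: "summable (\<lambda>k. cmod (w k * of_real (hermite k x)))" for x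
    using hermite_series_gaussian_bound[OF r w] by blast
  define g where "g k x = w k * of_real (hermite k x) * f x" for k x
  have ig: "integrable lborel (g k)" for k
    unfolding g_def mult.assoc
    by (intro integrable_mult_right integrable_mult_sq_integrable sq_integrable_hermite f)
  define K where "K = (LINT x|lborel. cmod (of_real (C * exp (- d * x\<^sup>2)) * f x))"
  have iK: "integrable lborel (\<lambda>x. cmod (of_real (C * exp (- d * x\<^sup>2)) * f x))"
    by (intro integrable_norm integrable_mult_sq_integrable f sq_integrable_gaussian C)
  have "(\<lambda>k. integral\<^sup>L lborel (g k)) sums (LINT x|lborel. (\<Sum>k. g k x))"
  proof (rule sums_integral)
    show "integrable lborel (g k)" for k by (rule ig)
    show "AE x in lborel. summable (\<lambda>k. norm (g k x))"
      unfolding g_def norm_mult[of "_ * _"] by (intro AE_I2 summable_mult2 sn)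
    show "summable (\<lambda>k. LINT x|lborel. norm (g k x))"
    proof (rule summable_comparison_test')
      show "summable (\<lambda>k. cmod (w k) / r ^ k * K)" by (intro summable_mult2 w)
      fix k
      have "(LINT x|lborel. norm (g k x))
          \<le> (LINT x|lborel. cmod (w k) / r ^ k * cmod (of_real (C * exp (- d * x\<^sup>2)) * f x))"
      proof (rule integral_mono)
        show "integrable lborel (\<lambda>x. norm (g k x))" by (intro integrable_norm ig)
        show "integrable lborel (\<lambda>x. cmod (w k) / r ^ k * cmod (of_real (C * exp (- d * x\<^sup>2)) * f x))"
          by (intro integrable_mult_right iK)
        fix x
        have "norm (g k x) = cmod (w k) / r ^ k * ((\<bar>hermite k x\<bar> * r ^ k) * cmod (f x))"
          using r by (simp add: g_def norm_mult)
        also have "\<dots> \<le> cmod (w k) / r ^ k * ((C * exp (- d * x\<^sup>2)) * cmod (f x))"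
          using r C(3)[of k x] by (intro mult_left_mono mult_right_mono) auto
        finally show "norm (g k x) \<le> cmod (w k) / r ^ k * cmod (of_real (C * exp (- d * x\<^sup>2)) * f x)"
          using C by (simp add: norm_mult)
      qed
      then show "norm (LINT x|lborel. norm (g k x)) \<le> cmod (w k) / r ^ k * K"
        by (simp add: K_def)
    qed
  qed
  moreover have "integral\<^sup>L lborel (g k) = w k * hermite_coeff f k" for k
    unfolding g_def hermite_coeff_def mult.assoc by simp
  moreover have "(\<Sum>k. g k x) = (\<Sum>k. w k * of_real (hermite k x)) * f x" for x
    unfolding g_def by (rule suminf_mult2[symmetric]) (rule summable_norm_cancel[OF sn])
  ultimately show ?thesis by simp
qed

text \<open>The terms carry only the square root of \<open>1 / fact k\<close>. Each is written as
  \<open>a * (1/2) ^ k\<close>, where \<open>a\<^sup>2\<close> is a term of the exponential series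
  at \<open>y\<close>, and is bounded by \<open>a\<^sup>2 + (1/4) ^ k\<close>. The 16 in
  \<open>y\<close> is the square of the 4 in \<open>a\<close>.\<close>

lemma summable_sqrt_exp_series:
  "summable (\<lambda>k. cmod (of_real (sqrt (pi ^ k / fact k)) * z ^ k) / (1/2) ^ k)"
proof (rule summable_comparison_test')
  define y where "y = 16 * pi * (cmod z)\<^sup>2"
  have "summable (\<lambda>k. y ^ k /\<^sub>R fact k)"
    using exp_converges[of y] by (rule sums_summable)
  moreover have "summable (\<lambda>k. (1/4 :: real) ^ k)"
    by (rule summable_geometric) simp
  ultimately show "summable (\<lambda>k. y ^ k / fact k + (1/4) ^ k)"
    by (intro summable_add) (simp_all add: field_simps)
  fix k
  define a where "a = cmod (of_real (sqrt (pi ^ k / fact k)) * z ^ k) * 4 ^ k"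
  have a2: "a\<^sup>2 = y ^ k / fact k"
  proof -
    have "a\<^sup>2 = pi ^ k / fact k * (((cmod z) ^ k)\<^sup>2 * (4 ^ k)\<^sup>2)"
      by (simp add: a_def norm_mult norm_power power_mult_distrib)
    also have "((cmod z) ^ k)\<^sup>2 * (4 ^ k)\<^sup>2 = (cmod z * cmod z * (4 * 4)) ^ k"
      by (simp only: power2_eq_square power_mult_distrib)
    also have "pi ^ k / fact k * (cmod z * cmod z * (4 * 4)) ^ k = (pi * (cmod z * cmod z * (4 * 4))) ^ k / fact k"
      by (simp only: power_mult_distrib times_divide_eq_left)
    finally show ?thesis
      by (simp add: y_def power2_eq_square mult_ac)
  qed
  have a0: "a \<ge> 0" by (simp add: a_def)
  have "cmod (of_real (sqrt (pi ^ k / fact k)) * z ^ k) / (1/2) ^ k = a * (1/2) ^ k"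
    by (simp add: a_def power_divide field_simps flip: power_mult_distrib)
  also have "\<dots> \<le> a\<^sup>2 + ((1/2) ^ k)\<^sup>2"
    using sum_squares_bound[of a "(1/2) ^ k"] mult_nonneg_nonneg[OF a0, of "(1/2) ^ k"] by simp
  also have "\<dots> = y ^ k / fact k + (1/4) ^ k"
    unfolding a2 by (simp add: power2_eq_square flip: power_mult_distrib)
  finally show "norm (cmod (of_real (sqrt (pi ^ k / fact k)) * z ^ k) / (1/2) ^ k) \<le> y ^ k / fact k + (1/4) ^ k"
    by simp
qed

lemma bargmann_sums:
  assumes "sq_integrable f"
  shows "(\<lambda>k. hermite_coeff f k * of_real (sqrt (pi ^ k / fact k)) * z ^ k) sums bargmann f z"
proof -
  have "bargmann_kernel z x = (\<Sum>k. of_real (sqrt (pi ^ k / fact k)) * z ^ k * of_real (hermite k x))" for x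
    using hermite_generating_function[of x z] by (simp add: sums_iff mult_ac)
  then show ?thesis
    using hermite_series_pairing[OF _ _ summable_sqrt_exp_series assms, of z]
    by (simp add: bargmann_def mult_ac)
qed

text \<open>For real parameters the product of two kernels is a multiple of the normal density with
  mean \<open>(z + w) / 2\<close> and variance \<open>1 / (4 * pi)\<close>. The value is the
  reproducing kernel of \<open>HL2 1\<close> at real points.\<close>

lemma bargmann_bargmann_kernel:
  fixes z w :: real
  shows "bargmann (bargmann_kernel (of_real w)) (of_real z) = of_real (exp (pi * z * w))"
proof -
  define s where "s = sqrt (1 / (4 * pi))"
  have s: "s > 0" "s\<^sup>2 = 1 / (4 * pi)" by (auto simp: s_def)
  define m where "m = (z + w) / 2"
  have "bargmann_kernel (of_real z) x * bargmann_kernel (of_real w) x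
      = of_real (exp (pi * z * w) * normal_density m s x)" for x
  proof -
    have "bargmann_kernel (of_real z) x * bargmann_kernel (of_real w) x
        = of_real ((2 powr (1/4) * 2 powr (1/4)) * (exp (- pi * x\<^sup>2 + 2 * pi * x * z - pi * z\<^sup>2 / 2)
            * exp (- pi * x\<^sup>2 + 2 * pi * x * w - pi * w\<^sup>2 / 2)))"
      by (simp add: bargmann_kernel_def mult_ac flip: exp_of_real)
    also have "2 powr (1/4) * 2 powr (1/4) = sqrt 2"
      by (simp add: powr_half_sqrt flip: powr_add)
    also have "exp (- pi * x\<^sup>2 + 2 * pi * x * z - pi * z\<^sup>2 / 2) * exp (- pi * x\<^sup>2 + 2 * pi * x * w - pi * w\<^sup>2 / 2)
        = exp (pi * z * w) * exp (- (x - m)\<^sup>2 / (2 * s\<^sup>2))"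
      unfolding exp_add[symmetric] s(2) m_def
      by (rule arg_cong[where f = exp]) (simp add: power2_eq_square field_simps)
    also have "sqrt 2 * (exp (pi * z * w) * exp (- (x - m)\<^sup>2 / (2 * s\<^sup>2))) = exp (pi * z * w) * normal_density m s x"
      unfolding normal_density_def by (simp add: s(2) real_sqrt_divide)
    finally show ?thesis .
  qed
  then have "bargmann (bargmann_kernel (of_real w)) (of_real z)
      = of_real (LINT x|lborel. exp (pi * z * w) * normal_density m s x)"
    unfolding bargmann_def by (simp only: integral_complex_of_real)
  then show ?thesis using s by simp
qed

text \<open>The transform of the kernel is expanded in \<open>z\<close> twice, through Hermite
  coefficients and as an exponential series.\<close>

lemma hermite_coeff_bargmann_kernel:
  fixes w :: real
  shows "hermite_coeff (bargmann_kernel (of_real w)) k = of_real (sqrt (pi ^ k / fact k) * w ^ k)"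
proof -
  have "(\<lambda>k. hermite_coeff (bargmann_kernel (of_real w)) k * of_real (sqrt (pi ^ k / fact k)))
      = (\<lambda>k. of_real ((pi * w) ^ k / fact k))"
  proof (rule powser_unique_at_right_complex[of 1], simp, rule conjI)
    fix x :: real
    show "(\<lambda>k. hermite_coeff (bargmann_kernel (of_real w)) k * of_real (sqrt (pi ^ k / fact k)) * of_real x ^ k)
        sums of_real (exp (pi * x * w))"
      using bargmann_sums[OF sq_integrable_bargmann_kernel, of "of_real w" "of_real x"]
      by (simp only: bargmann_bargmann_kernel)
    have "(\<lambda>k. (pi * x * w) ^ k /\<^sub>R fact k) sums exp (pi * x * w)"
      by (rule exp_converges)
    then have "(\<lambda>k. complex_of_real ((pi * x * w) ^ k /\<^sub>R fact k)) sums of_real (exp (pi * x * w))"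
      by (rule sums_of_real)
    then show "(\<lambda>k. of_real ((pi * w) ^ k / fact k) * of_real x ^ k) sums complex_of_real (exp (pi * x * w))"
      by (simp add: power_mult_distrib field_simps)
  qed
  then have "hermite_coeff (bargmann_kernel (of_real w)) k * of_real (sqrt (pi ^ k / fact k))
      = of_real (sqrt (pi ^ k / fact k) * w ^ k) * of_real (sqrt (pi ^ k / fact k))"
    by (simp add: fun_eq_iff power_mult_distrib flip: of_real_mult of_real_power)
      (simp add: mult_ac flip: power_mult_distrib)
  then show ?thesis by simp
qed

text \<open>By symmetry of the pairing, the transform of the \<open>j\<close>-th Hermite function at
  \<open>x\<close> is the \<open>j\<close>-th coefficient of the kernel at \<open>x\<close>, hence a
  multiple of \<open>x ^ j\<close>. Its expansion by \<open>bargmann_sums\<close> can thus have only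
  one nonzero coefficient.\<close>

lemma hermite_orthonormal:
  "hermite_coeff (\<lambda>x. of_real (hermite j x)) k = (if j = k then 1 else 0)"
proof -
  have "(\<lambda>k. hermite_coeff (\<lambda>x. of_real (hermite j x)) k * of_real (sqrt (pi ^ k / fact k)))
      = (\<lambda>k. if k = j then of_real (sqrt (pi ^ k / fact k)) else 0)"
  proof (rule powser_unique_at_right_complex[of 1], simp, rule conjI)
    fix x :: real
    have "bargmann (\<lambda>x. of_real (hermite j x)) (of_real x) = hermite_coeff (bargmann_kernel (of_real x)) j"
      by (simp add: bargmann_def hermite_coeff_def mult.commute)
    then show "(\<lambda>k. hermite_coeff (\<lambda>x. of_real (hermite j x)) k * of_real (sqrt (pi ^ k / fact k)) * of_real x ^ k)
        sums of_real (sqrt (pi ^ j / fact j) * x ^ j)"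
      using bargmann_sums[OF sq_integrable_hermite, of j "of_real x"]
      by (simp only: hermite_coeff_bargmann_kernel)
    show "(\<lambda>k. (if k = j then of_real (sqrt (pi ^ k / fact k)) else 0) * of_real x ^ k)
        sums complex_of_real (sqrt (pi ^ j / fact j) * x ^ j)"
      using sums_single[of j "\<lambda>k. complex_of_real (sqrt (pi ^ k / fact k)) * of_real x ^ k"]
      by (simp add: if_distrib[of "\<lambda>c. c * _"] cong: if_cong)
  qed
  then have "hermite_coeff (\<lambda>x. of_real (hermite j x)) k * of_real (sqrt (pi ^ k / fact k))
      = (if k = j then of_real (sqrt (pi ^ k / fact k)) else 0)"
    by (rule fun_cong)
  then show ?thesis by (auto split: if_splits)
qed

subsection \<open>Completeness of the Hermite functions\<close>

lemma hermite_coeff_add: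
  assumes "sq_integrable f" "sq_integrable g"
  shows "hermite_coeff (\<lambda>x. f x + g x) k = hermite_coeff f k + hermite_coeff g k"
  unfolding hermite_coeff_def ring_distribs
  by (intro Bochner_Integration.integral_add integrable_mult_sq_integrable sq_integrable_hermite assms)

lemma hermite_coeff_scale: "hermite_coeff (\<lambda>x. a * f x) k = a * hermite_coeff f k"
  unfolding hermite_coeff_def by (simp add: mult.left_commute[of _ a])

lemma hermite_coeff_diff_scale:
  assumes "sq_integrable f" "sq_integrable g"
  shows "hermite_coeff (\<lambda>x. f x - b * g x) k = hermite_coeff f k - b * hermite_coeff g k"
  using hermite_coeff_add[OF assms(1) sq_integrable_scale[OF assms(2), of "- b"], of k]
    hermite_coeff_scale[of "- b" g k] by simp

lemma L2_norm_sq_diff_hermite: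
  assumes f: "sq_integrable f"
  shows "L2_norm_sq (\<lambda>x. f x - b * of_real (hermite k x))
    = L2_norm_sq f - 2 * Re (cnj b * hermite_coeff f k) + (cmod b)\<^sup>2"
proof -
  let ?h = "\<lambda>x. complex_of_real (hermite k x)"
  have pt: "complex_of_real ((cmod (f x - b * ?h x))\<^sup>2) = of_real ((cmod (f x))\<^sup>2)
      - (cnj b * (?h x * f x) + b * (?h x * cnj (f x))) + of_real ((cmod b)\<^sup>2) * (?h x * ?h x)" for x
    unfolding complex_norm_square by (simp add: algebra_simps)
  have i1: "integrable lborel (\<lambda>x. complex_of_real ((cmod (f x))\<^sup>2))"
    using f by (auto simp: sq_integrable_def simp del: of_real_power)
  have i2: "integrable lborel (\<lambda>x. ?h x * f x)" "integrable lborel (\<lambda>x. ?h x * cnj (f x))"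
    "integrable lborel (\<lambda>x. ?h x * ?h x)"
    by (intro integrable_mult_sq_integrable sq_integrable_hermite sq_integrable_cnj f)+
  have "(LINT x|lborel. ?h x * cnj (f x)) = cnj (hermite_coeff f k)"
    unfolding hermite_coeff_def
    by (subst Bochner_Integration.integral_cnj[symmetric]) simp
  moreover have "(LINT x|lborel. ?h x * ?h x) = 1"
    using hermite_orthonormal[of k k] by (simp add: hermite_coeff_def)
  ultimately have "complex_of_real (L2_norm_sq (\<lambda>x. f x - b * ?h x))
      = of_real (L2_norm_sq f) - (cnj b * hermite_coeff f k + b * cnj (hermite_coeff f k)) + of_real ((cmod b)\<^sup>2)"
    unfolding L2_norm_sq_def integral_complex_of_real[symmetric] pt
    using i1 i2 by (simp add: hermite_coeff_def del: of_real_power)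
  also have "cnj b * hermite_coeff f k + b * cnj (hermite_coeff f k) = of_real (2 * Re (cnj b * hermite_coeff f k))"
    by (subst complex_add_cnj[symmetric]) simp
  finally show ?thesis
    by (metis (no_types, lifting) of_real_add of_real_diff of_real_eq_iff)
qed

lemma hermite_coeff_diff_hermite_sum:
  assumes "sq_integrable f" "finite I"
  shows "hermite_coeff (\<lambda>x. f x - (\<Sum>k\<in>I. b k * of_real (hermite k x))) n
    = hermite_coeff f n - (if n \<in> I then b n else 0)"
  using assms(2)
proof (induction I)
  case (insert k I)
  have "hermite_coeff (\<lambda>x. f x - (\<Sum>k\<in>insert k I. b k * of_real (hermite k x))) n
      = hermite_coeff (\<lambda>x. (f x - (\<Sum>k\<in>I. b k * of_real (hermite k x))) - b k * of_real (hermite k x)) n"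
    using insert by (simp add: algebra_simps)
  also have "\<dots> = hermite_coeff f n - (if n \<in> I then b n else 0) - b k * (if n = k then 1 else 0)"
    by (subst hermite_coeff_diff_scale)
      (auto simp: insert.IH hermite_orthonormal
        intro!: sq_integrable_diff sq_integrable_sum sq_integrable_scale sq_integrable_hermite assms)
  finally show ?case using insert by auto
qed simp

text \<open>The \<open>b k\<close> are left free: taking the coefficients of \<open>f\<close> gives
  Bessel's inequality, and taking \<open>f = 0\<close> gives the norm of a finite
  combination.\<close>

lemma L2_norm_sq_diff_hermite_sum:
  assumes "sq_integrable f" "finite I"
  shows "L2_norm_sq (\<lambda>x. f x - (\<Sum>k\<in>I. b k * of_real (hermite k x)))
    = L2_norm_sq f + (\<Sum>k\<in>I. (cmod (b k))\<^sup>2 - 2 * Re (cnj (b k) * hermite_coeff f k))"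
  using assms(2)
proof (induction I)
  case (insert k I)
  have "L2_norm_sq (\<lambda>x. f x - (\<Sum>k\<in>insert k I. b k * of_real (hermite k x)))
      = L2_norm_sq (\<lambda>x. (f x - (\<Sum>k\<in>I. b k * of_real (hermite k x))) - b k * of_real (hermite k x))"
    using insert by (simp add: algebra_simps)
  also have "\<dots> = L2_norm_sq (\<lambda>x. f x - (\<Sum>k\<in>I. b k * of_real (hermite k x)))
      - 2 * Re (cnj (b k) * hermite_coeff f k) + (cmod (b k))\<^sup>2"
    using insert
    by (subst L2_norm_sq_diff_hermite)
      (auto simp: hermite_coeff_diff_hermite_sum assms
        intro!: sq_integrable_diff sq_integrable_sum sq_integrable_scale sq_integrable_hermite assms)
  finally show ?case using insert by simp
qed simp

lemma L2_norm_sq_nonneg: "L2_norm_sq f \<ge> 0"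
  unfolding L2_norm_sq_def by (rule Bochner_Integration.integral_nonneg) simp

lemma Re_cnj_mult_self: "Re (cnj c * c) = (cmod c)\<^sup>2"
  by (simp add: cmod_power2) (simp add: power2_eq_square)

lemma bessel_inequality:
  assumes f: "sq_integrable f" and "finite I"
  shows "(\<Sum>k\<in>I. (cmod (hermite_coeff f k))\<^sup>2) \<le> L2_norm_sq f"
proof -
  have "0 \<le> L2_norm_sq f + (\<Sum>k\<in>I. (cmod (hermite_coeff f k))\<^sup>2 - 2 * Re (cnj (hermite_coeff f k) * hermite_coeff f k))"
    unfolding L2_norm_sq_diff_hermite_sum[OF assms, symmetric] by (rule L2_norm_sq_nonneg)
  then show ?thesis
    unfolding Re_cnj_mult_self by (simp add: sum_negf)
qed

lemma nn_integral_L2_norm_sq: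
  "sq_integrable f \<Longrightarrow> (\<integral>\<^sup>+x. ennreal ((cmod (f x))\<^sup>2) \<partial>lborel) = ennreal (L2_norm_sq f)"
  unfolding L2_norm_sq_def by (rule nn_integral_eq_integral) (auto simp: sq_integrable_def)

lemma L2_norm_sq_hermite_sum:
  assumes "finite I"
  shows "L2_norm_sq (\<lambda>x. \<Sum>k\<in>I. b k * of_real (hermite k x)) = (\<Sum>k\<in>I. (cmod (b k))\<^sup>2)"
proof -
  have "L2_norm_sq (\<lambda>x. \<Sum>k\<in>I. b k * of_real (hermite k x))
      = L2_norm_sq (\<lambda>x. 0 - (\<Sum>k\<in>I. b k * of_real (hermite k x)))"
    by (simp add: L2_norm_sq_def)
  also have "\<dots> = (\<Sum>k\<in>I. (cmod (b k))\<^sup>2)"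
    by (subst L2_norm_sq_diff_hermite_sum[OF sq_integrable_zero assms])
      (simp add: L2_norm_sq_def hermite_coeff_def)
  finally show ?thesis .
qed

text \<open>Completeness of L2 for this orthonormal system: a fast subsequence of the partial sums
  converges almost everywhere, and Fatou turns this into convergence in norm. The inequality for the
  norm later combines with Bessel's into Parseval.\<close>

lemma riesz_fischer_hermite:
  assumes b: "summable (\<lambda>k. (cmod (b k))\<^sup>2)"
  obtains f where "sq_integrable f" "\<And>k. hermite_coeff f k = b k"
    "L2_norm_sq f \<le> (\<Sum>k. (cmod (b k))\<^sup>2)"
proof -
  define S where "S n x = (\<Sum>k<n. b k * complex_of_real (hermite k x))" for n x
  have sqS: "sq_integrable (S n)" for n
    unfolding S_def by (intro sq_integrable_sum sq_integrable_scale sq_integrable_hermite)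
  then have [measurable]: "S n \<in> borel_measurable borel" for n by (simp add: sq_integrable_def)
  have block: "(\<integral>\<^sup>+x. ennreal ((cmod (S n x - S m x))\<^sup>2) \<partial>lborel) = ennreal (\<Sum>k\<in>{m..<n}. (cmod (b k))\<^sup>2)"
    if "m \<le> n" for m n
  proof -
    have "S n x - S m x = (\<Sum>k\<in>{m..<n}. b k * complex_of_real (hermite k x))" for x
      unfolding S_def using sum_diff_nat_ivl[of 0 m n "\<lambda>k. b k * complex_of_real (hermite k x)"] that
      by (simp add: atLeast0LessThan)
    then show ?thesis
      by (simp add: nn_integral_L2_norm_sq sq_integrable_sum sq_integrable_scale sq_integrable_hermite
          L2_norm_sq_hermite_sum)
  qed
  have "\<exists>N. \<forall>m\<ge>N. \<forall>n. (\<Sum>k\<in>{m..<n}. (cmod (b k))\<^sup>2) < (1/4) ^ j" for j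
    using b[unfolded summable_Cauchy, rule_format, of "(1/4) ^ j"] by (auto simp: sum_nonneg)
  then obtain M where M: "\<And>j m n. m \<ge> M j \<Longrightarrow> (\<Sum>k\<in>{m..<n}. (cmod (b k))\<^sup>2) < (1/4) ^ j"
    by metis
  \<comment> \<open>The sum makes \<open>N\<close> monotone and at least \<open>M j\<close>; the
    summand \<open>j\<close> makes it unbounded, so every index is eventually below
    \<open>N j\<close>.\<close>
  define N where "N j = j + (\<Sum>i\<le>j. M i)" for j
  have NM: "M j \<le> N j" for j
    using member_le_sum[of j "{..j}" M] by (simp add: N_def)
  have monoN: "mono N"
    by (rule incseq_SucI) (simp add: N_def)
  have Nge: "j \<le> N j" for j by (simp add: N_def)
  define g where "g j x = S (N (Suc j)) x - S (N j) x" for j x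
  have [measurable]: "g j \<in> borel_measurable borel" for j unfolding g_def by measurable
  \<comment> \<open>Where the series diverges, \<open>suminf\<close> has an unspecified value;
    \<open>conv\<close> shows that such points form a null set.\<close>
  define f where "f x = S (N 0) x + (\<Sum>j. g j x)" for x
  have [measurable]: "f \<in> borel_measurable borel" unfolding f_def by measurable
  have gb: "(\<integral>\<^sup>+x. ennreal ((cmod (g j x))\<^sup>2) \<partial>lborel) \<le> ennreal ((1/4) ^ j)" for j
    unfolding g_def using M[OF NM, of j "N (Suc j)"] monoD[OF monoN, of j "Suc j"]
    by (subst block) (auto intro: ennreal_leI)
  \<comment> \<open>The weight \<open>2 ^ j\<close> is still beaten by the norm bound
    \<open>(1/4) ^ j\<close>, and it controls the first powers: \<open>cmod (g j x) \<le> 2 ^ j *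
    (cmod (g j x))\<^sup>2 + (1/2) ^ j\<close>.\<close>
  have "(\<integral>\<^sup>+x. (\<Sum>j. ennreal (2 ^ j * (cmod (g j x))\<^sup>2)) \<partial>lborel)
      = (\<Sum>j. \<integral>\<^sup>+x. ennreal (2 ^ j * (cmod (g j x))\<^sup>2) \<partial>lborel)"
    by (rule nn_integral_suminf) measurable
  also have "\<dots> \<le> (\<Sum>j. ennreal ((1/2) ^ j))"
  proof (rule suminf_le)
    fix j
    have "(\<integral>\<^sup>+x. ennreal (2 ^ j * (cmod (g j x))\<^sup>2) \<partial>lborel)
        = ennreal (2 ^ j) * (\<integral>\<^sup>+x. ennreal ((cmod (g j x))\<^sup>2) \<partial>lborel)"
      by (subst nn_integral_cmult[symmetric]) (auto simp: ennreal_mult')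
    also have "\<dots> \<le> ennreal (2 ^ j) * ennreal ((1/4) ^ j)"
      by (intro mult_left_mono gb) auto
    also have "\<dots> = ennreal ((1/2) ^ j)"
      by (subst ennreal_mult'[symmetric]) (auto simp flip: power_mult_distrib)
    finally show "(\<integral>\<^sup>+x. ennreal (2 ^ j * (cmod (g j x))\<^sup>2) \<partial>lborel) \<le> ennreal ((1/2) ^ j)" .
  qed auto
  also have "\<dots> = ennreal 2"
    by (rule suminf_ennreal_eq) (use geometric_sums[of "1/2 :: real"] in auto)
  finally have "(\<integral>\<^sup>+x. (\<Sum>j. ennreal (2 ^ j * (cmod (g j x))\<^sup>2)) \<partial>lborel) \<noteq> \<infinity>"
    by (auto simp: top_unique)
  then have "AE x in lborel. (\<Sum>j. ennreal (2 ^ j * (cmod (g j x))\<^sup>2)) \<noteq> \<infinity>"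
    by (intro nn_integral_PInf_AE) auto
  then have conv: "AE x in lborel. (\<lambda>j. S (N j) x) \<longlonglongrightarrow> f x"
  proof eventually_elim
    case (elim x)
    have s: "summable (\<lambda>j. 2 ^ j * (cmod (g j x))\<^sup>2)"
      by (rule summable_suminf_not_top) (use elim in auto)
    have "summable (\<lambda>j. g j x)"
    proof (rule summable_comparison_test')
      show "summable (\<lambda>j. 2 ^ j * (cmod (g j x))\<^sup>2 + (1/2) ^ j)"
        by (intro summable_add s summable_geometric) simp
      fix j
      have "2 * (2 ^ j * cmod (g j x)) \<le> (2 ^ j * cmod (g j x))\<^sup>2 + 1"
        using sum_squares_bound[of "2 ^ j * cmod (g j x)" 1] by simp
      then have "2 ^ j * cmod (g j x) \<le> 2 ^ j * (2 ^ j * (cmod (g j x))\<^sup>2 + (1/2) ^ j)"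
        by (simp add: power2_eq_square algebra_simps flip: power_mult_distrib)
          (smt (verit) mult_nonneg_nonneg norm_ge_zero zero_le_power)
      then show "norm (g j x) \<le> 2 ^ j * (cmod (g j x))\<^sup>2 + (1/2) ^ j"
        by (simp add: mult_le_cancel_left)
    qed
    then have "(\<lambda>n. S (N 0) x + (\<Sum>j<n. g j x)) \<longlonglongrightarrow> f x"
      unfolding f_def by (intro tendsto_intros summable_LIMSEQ)
    moreover have "S (N 0) x + (\<Sum>j<n. g j x) = S (N n) x" for n
      unfolding g_def using sum_lessThan_telescope[of "\<lambda>j. S (N j) x" n] by simp
    ultimately show ?case by simp
  qed
  \<comment> \<open>Fatou: the difference is almost everywhere the limit of the blocks
    \<open>S (N n) x - S (N j) x\<close>, whose norms are bounded independently of
    \<open>n\<close>.\<close>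
  have tail: "(\<integral>\<^sup>+x. ennreal ((cmod (f x - S (N j) x))\<^sup>2) \<partial>lborel) \<le> ennreal ((1/4) ^ j)" for j
  proof -
    have "(\<integral>\<^sup>+x. ennreal ((cmod (f x - S (N j) x))\<^sup>2) \<partial>lborel)
        = (\<integral>\<^sup>+x. liminf (\<lambda>n. ennreal ((cmod (S (N n) x - S (N j) x))\<^sup>2)) \<partial>lborel)"
    proof (rule nn_integral_cong_AE, use conv in eventually_elim)
      case (elim x)
      then have "(\<lambda>n. ennreal ((cmod (S (N n) x - S (N j) x))\<^sup>2)) \<longlonglongrightarrow> ennreal ((cmod (f x - S (N j) x))\<^sup>2)"
        by (intro tendsto_intros)
      then show ?case by (rule lim_imp_Liminf[OF sequentially_bot, symmetric])
    qed
    also have "\<dots> \<le> liminf (\<lambda>n. \<integral>\<^sup>+x. ennreal ((cmod (S (N n) x - S (N j) x))\<^sup>2) \<partial>lborel)"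
      by (rule nn_integral_liminf) measurable
    also have "\<dots> \<le> liminf (\<lambda>n. ennreal ((1/4) ^ j))"
    proof (rule Liminf_mono)
      show "\<forall>\<^sub>F n in sequentially. (\<integral>\<^sup>+x. ennreal ((cmod (S (N n) x - S (N j) x))\<^sup>2) \<partial>lborel) \<le> ennreal ((1/4) ^ j)"
        using eventually_ge_at_top[of j]
      proof eventually_elim
        case (elim n)
        then show ?case
          using M[OF NM, of j "N n"] monoD[OF monoN elim]
          by (subst block) (auto intro: ennreal_leI)
      qed
    qed
    finally show ?thesis by (simp add: Liminf_const)
  qed
  have sqd: "sq_integrable (\<lambda>x. f x - S (N j) x)" for j
    unfolding sq_integrable_def
    using order_le_less_trans[OF tail[of j] ennreal_less_top]
    by (auto intro!: integrableI_nonneg)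
  have sqf: "sq_integrable f"
    using sq_integrable_add[OF sqd[of 0] sqS[of "N 0"]] by simp
  have tail': "L2_norm_sq (\<lambda>x. f x - S (N j) x) \<le> (1/4) ^ j" for j
    using tail[of j] by (simp add: nn_integral_L2_norm_sq[OF sqd])
  have lim0: "(\<lambda>j. (1/4 :: real) ^ j) \<longlonglongrightarrow> 0"
    by (rule LIMSEQ_realpow_zero) auto
  have coeff: "hermite_coeff f k = b k" for k
  proof -
    have le: "(cmod (hermite_coeff f k - b k))\<^sup>2 \<le> (1/4) ^ j" if "j > k" for j
    proof -
      have "k < N j" using that Nge[of j] by simp
      then have "hermite_coeff f k - b k = hermite_coeff (\<lambda>x. f x - S (N j) x) k"
        unfolding S_def by (subst hermite_coeff_diff_hermite_sum[OF sqf]) auto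
      then have "(cmod (hermite_coeff f k - b k))\<^sup>2 \<le> L2_norm_sq (\<lambda>x. f x - S (N j) x)"
        using bessel_inequality[OF sqd[of j], of "{k}"] by simp
      also have "\<dots> \<le> (1/4) ^ j" by (rule tail')
      finally show ?thesis .
    qed
    have "(cmod (hermite_coeff f k - b k))\<^sup>2 \<le> 0"
      by (rule LIMSEQ_le_const[OF lim0]) (use le in \<open>auto intro!: exI[of _ "Suc k"]\<close>)
    then show ?thesis by simp
  qed
  have "L2_norm_sq f \<le> (1/4) ^ j + (\<Sum>k. (cmod (b k))\<^sup>2)" for j
  proof -
    have "L2_norm_sq (\<lambda>x. f x - S (N j) x)
        = L2_norm_sq f + (\<Sum>k<N j. (cmod (b k))\<^sup>2 - 2 * Re (cnj (b k) * b k))"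
      unfolding S_def by (subst L2_norm_sq_diff_hermite_sum[OF sqf]) (simp_all only: coeff finite_lessThan)
    also have "(\<Sum>k<N j. (cmod (b k))\<^sup>2 - 2 * Re (cnj (b k) * b k)) = - (\<Sum>k<N j. (cmod (b k))\<^sup>2)"
      unfolding Re_cnj_mult_self by (simp add: sum_negf)
    finally have "L2_norm_sq f \<le> (1/4) ^ j + (\<Sum>k<N j. (cmod (b k))\<^sup>2)"
      using tail'[of j] by simp
    also have "(\<Sum>k<N j. (cmod (b k))\<^sup>2) \<le> (\<Sum>k. (cmod (b k))\<^sup>2)"
      by (rule sum_le_suminf[OF b]) auto
    finally show ?thesis by simp
  qed
  moreover have "(\<lambda>j. (1/4) ^ j + (\<Sum>k. (cmod (b k))\<^sup>2)) \<longlonglongrightarrow> 0 + (\<Sum>k. (cmod (b k))\<^sup>2)"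
    by (intro tendsto_intros lim0)
  ultimately have "L2_norm_sq f \<le> 0 + (\<Sum>k. (cmod (b k))\<^sup>2)"
    by (intro LIMSEQ_le_const) auto
  with sqf coeff show thesis by (intro that) auto
qed

section \<open>Integrable functions with vanishing Fourier transform\<close>

text \<open>The positive and negative parts have equal transforms, and \<open>s = 0\<close> gives
  them equal mass \<open>m\<close>. If \<open>m > 0\<close>, both normalize to probability densities
  with the same characteristic function, so Levy's uniqueness theorem applies; if
  \<open>m = 0\<close>, both vanish almost everywhere.\<close>

lemma fourier_zero_imp_AE_zero_real:
  fixes G :: "real \<Rightarrow> real"
  assumes G: "integrable lborel G"
    and F: "\<And>s. (LINT x|lborel. iexp (s * x) * complex_of_real (G x)) = 0"
  shows "AE x in lborel. G x = 0"
proof -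
  define P where "P x = max (G x) 0" for x
  define Q where "Q x = max (- G x) 0" for x
  have GPQ: "G x = P x - Q x" for x by (simp add: P_def Q_def max_def)
  have iP: "integrable lborel P" and iQ: "integrable lborel Q"
    unfolding P_def[abs_def] Q_def[abs_def] using G by auto
  have [measurable]: "P \<in> borel_measurable borel" "Q \<in> borel_measurable borel"
    using iP iQ by auto
  have P0: "P x \<ge> 0" and Q0: "Q x \<ge> 0" for x by (auto simp: P_def Q_def)
  define m where "m = (LINT x|lborel. P x)"
  have eq: "(LINT x|lborel. iexp (s * x) * complex_of_real (P x)) = (LINT x|lborel. iexp (s * x) * complex_of_real (Q x))" for s
  proof -
    have i: "integrable lborel (\<lambda>x. iexp (s * x) * complex_of_real (R x))"
      if "integrable lborel R" for R
    proof (rule Bochner_Integration.integrable_bound[OF that])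
      have [measurable]: "R \<in> borel_measurable borel" using that by auto
      show "(\<lambda>x. iexp (s * x) * complex_of_real (R x)) \<in> borel_measurable lborel" by measurable
    qed (auto simp: norm_mult)
    have "(LINT x|lborel. iexp (s * x) * complex_of_real (G x))
        = (LINT x|lborel. iexp (s * x) * complex_of_real (P x) - iexp (s * x) * complex_of_real (Q x))"
      unfolding GPQ by (simp only: of_real_diff right_diff_distrib)
    also have "\<dots> = (LINT x|lborel. iexp (s * x) * complex_of_real (P x))
        - (LINT x|lborel. iexp (s * x) * complex_of_real (Q x))"
      by (rule Bochner_Integration.integral_diff[OF i[OF iP] i[OF iQ]])
    finally show ?thesis by (simp only: F right_minus_eq eq_commute[of 0])
  qed
  have mQ: "(LINT x|lborel. Q x) = m"
  proof -
    have "complex_of_real (LINT x|lborel. P x) = of_real (LINT x|lborel. Q x)"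
      using eq[of 0] by simp
    then show ?thesis by (simp only: of_real_eq_iff m_def)
  qed
  show ?thesis
  proof (cases "m = 0")
    case True
    then have "AE x in lborel. P x = 0" "AE x in lborel. Q x = 0"
      using integral_nonneg_eq_0_iff_AE[OF iP] integral_nonneg_eq_0_iff_AE[OF iQ] mQ P0 Q0
      by (auto simp: m_def)
    then show ?thesis by eventually_elim (simp add: GPQ)
  next
    case False
    have "m \<ge> 0" unfolding m_def by (rule Bochner_Integration.integral_nonneg) (rule P0)
    with False have m: "m > 0" by simp
    have distr: "real_distribution (density lborel (\<lambda>x. ennreal (R x / m)))"
      if R: "integrable lborel R" "\<And>x. R x \<ge> 0" "(LINT x|lborel. R x) = m" for R
    proof -
      have [measurable]: "R \<in> borel_measurable borel" using R by auto
      have "(\<integral>\<^sup>+x. ennreal (R x / m) \<partial>lborel) = ennreal (LINT x|lborel. R x / m)"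
        using R m by (intro nn_integral_eq_integral) auto
      also have "\<dots> = 1" using R m by simp
      finally have "(\<integral>\<^sup>+x. ennreal (R x / m) \<partial>lborel) = 1" .
      then show ?thesis
        by (intro real_distribution.intro prob_spaceI real_distribution_axioms.intro)
          (auto simp: emeasure_density)
    qed
    have char: "char (density lborel (\<lambda>x. ennreal (R x / m))) s
        = (LINT x|lborel. iexp (s * x) * complex_of_real (R x)) / m"
      if R: "integrable lborel R" "\<And>x. R x \<ge> 0" for R s
    proof -
      have [measurable]: "R \<in> borel_measurable borel" using R by auto
      have "char (density lborel (\<lambda>x. ennreal (R x / m))) s = (LINT x|lborel. (R x / m) *\<^sub>R iexp (s * x))"
        unfolding char_def using R m by (subst integral_density) auto
      also have "\<dots> = (LINT x|lborel. (iexp (s * x) * complex_of_real (R x)) / m)"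
        by (simp add: scaleR_conv_of_real mult_ac)
      finally show ?thesis by simp
    qed
    have "density lborel (\<lambda>x. ennreal (P x / m)) = density lborel (\<lambda>x. ennreal (Q x / m))"
      by (rule Levy_uniqueness[OF distr[OF iP P0] distr[OF iQ Q0 mQ]])
        (simp_all only: m_def[symmetric] char[OF iP P0] char[OF iQ Q0] eq fun_eq_iff simp_thms)
    then have "AE x in lborel. ennreal (P x / m) = ennreal (Q x / m)"
      by (intro sigma_finite_measure.density_unique[OF sigma_finite_lborel]) auto
    then show ?thesis
    proof eventually_elim
      case (elim x)
      then show ?case using P0[of x] Q0[of x] m by (simp add: GPQ)
    qed
  qed
qed

text \<open>The transform of \<open>cnj G\<close> at \<open>s\<close> is the conjugate of that of
  \<open>G\<close> at \<open>- s\<close>, so the real and imaginary parts of \<open>G\<close>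
  inherit the vanishing.\<close>

lemma fourier_zero_imp_AE_zero:
  fixes G :: "real \<Rightarrow> complex"
  assumes G: "integrable lborel G"
    and F: "\<And>s. (LINT x|lborel. iexp (s * x) * G x) = 0"
  shows "AE x in lborel. G x = 0"
proof -
  have [measurable]: "G \<in> borel_measurable borel" using G by auto
  have i: "integrable lborel (\<lambda>x. iexp (s * x) * G x)" "integrable lborel (\<lambda>x. iexp (s * x) * cnj (G x))" for s
    by (rule Bochner_Integration.integrable_bound[OF G],
        auto simp: norm_mult intro!: borel_measurable_times borel_measurable_continuous_on[OF continuous_on_cnj[OF continuous_on_id]])+
  have C: "(LINT x|lborel. iexp (s * x) * cnj (G x)) = 0" for s
  proof -
    have "(LINT x|lborel. iexp (s * x) * cnj (G x)) = (LINT x|lborel. cnj (iexp (- s * x) * G x))"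
      by (simp add: exp_cnj)
    also have "\<dots> = 0" by (subst Bochner_Integration.integral_cnj) (simp only: F complex_cnj_zero)
    finally show ?thesis .
  qed
  have ReG: "AE x in lborel. Re (G x) = 0"
  proof (rule fourier_zero_imp_AE_zero_real)
    fix s
    have "(LINT x|lborel. iexp (s * x) * complex_of_real (Re (G x)))
        = (LINT x|lborel. (iexp (s * x) * G x + iexp (s * x) * cnj (G x)) / 2)"
      by (intro Bochner_Integration.integral_cong refl) (simp add: complex_add_cnj flip: distrib_left)
    also have "\<dots> = 0" using i[of s] F[of s] C[of s] by simp
    finally show "(LINT x|lborel. iexp (s * x) * complex_of_real (Re (G x))) = 0" .
  qed (use G in auto)
  have Im_eq: "complex_of_real (Im w) = (w - cnj w) / (2 * \<i>)" for w
    by (simp add: complex_eq_iff)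
  have "AE x in lborel. Im (G x) = 0"
  proof (rule fourier_zero_imp_AE_zero_real)
    fix s
    have "(LINT x|lborel. iexp (s * x) * complex_of_real (Im (G x)))
        = (LINT x|lborel. (iexp (s * x) * G x - iexp (s * x) * cnj (G x)) / (2 * \<i>))"
      unfolding Im_eq by (simp only: times_divide_eq_right right_diff_distrib)
    also have "\<dots> = 0" using i[of s] F[of s] C[of s] by simp
    finally show "(LINT x|lborel. iexp (s * x) * complex_of_real (Im (G x))) = 0" .
  qed (use G in auto)
  with ReG show ?thesis
    by eventually_elim (simp add: complex_eq_iff)
qed

lemma hermite_complete:
  assumes g: "sq_integrable g" and c: "\<And>k. hermite_coeff g k = 0"
  shows "AE x in lborel. g x = 0"
proof -
  have B: "bargmann g z = 0" for z
    using bargmann_sums[OF g, of z] by (simp add: c sums_iff)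
  define G where "G x = complex_of_real (exp (- pi * x\<^sup>2)) * g x" for x
  have "AE x in lborel. G x = 0"
  proof (rule fourier_zero_imp_AE_zero)
    show "integrable lborel G"
      unfolding G_def[abs_def] using sq_integrable_gaussian[of pi 1]
      by (intro integrable_mult_sq_integrable g) auto
    fix s
    \<comment> \<open>On the imaginary axis the mixed term \<open>2 * pi * x * z\<close> of the
      exponent becomes \<open>\<i> * s * x\<close>: the kernel is a nonzero constant times a
      character times a Gaussian.\<close>
    define z where "z = \<i> * of_real (s / (2 * pi))"
    define a where "a = of_real (2 powr (1/4)) * exp (- of_real pi * z\<^sup>2 / 2)"
    have "bargmann_kernel z x * g x = a * (iexp (s * x) * G x)" for x
    proof -
      have "- of_real pi * (of_real x)\<^sup>2 + 2 * of_real pi * of_real x * z - of_real pi * z\<^sup>2 / 2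
          = - of_real pi * z\<^sup>2 / 2 + \<i> * of_real (s * x) + of_real (- pi * x\<^sup>2)"
        by (simp add: z_def)
      then show ?thesis
        unfolding bargmann_kernel_def a_def G_def
        by (simp only: exp_add exp_of_real mult_ac)
    qed
    then have "bargmann g z = a * (LINT x|lborel. iexp (s * x) * G x)"
      unfolding bargmann_def by simp
    moreover have "a \<noteq> 0" by (simp add: a_def)
    ultimately show "(LINT x|lborel. iexp (s * x) * G x) = 0"
      using B[of z] by simp
  qed
  then show ?thesis
    by eventually_elim (simp add: G_def)
qed

text \<open>The Riesz-Fischer function built from the coefficients of \<open>f\<close> agrees with
  \<open>f\<close> almost everywhere by completeness. Its norm bound and Bessel's inequality for
  \<open>f\<close> are the two halves of the equality.\<close>

lemma hermite_parseval:
  assumes f: "sq_integrable f"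
  shows "(\<lambda>k. (cmod (hermite_coeff f k))\<^sup>2) sums L2_norm_sq f"
proof -
  have sm: "summable (\<lambda>k. (cmod (hermite_coeff f k))\<^sup>2)"
    by (rule summableI_nonneg_bounded) (use bessel_inequality[OF f] in auto)
  obtain g where g: "sq_integrable g" "\<And>k. hermite_coeff g k = hermite_coeff f k"
    "L2_norm_sq g \<le> (\<Sum>k. (cmod (hermite_coeff f k))\<^sup>2)"
    using riesz_fischer_hermite[OF sm] by blast
  have [measurable]: "f \<in> borel_measurable borel" "g \<in> borel_measurable borel"
    using f g by (auto simp: sq_integrable_def)
  have "AE x in lborel. f x - 1 * g x = 0"
    by (rule hermite_complete)
      (use sq_integrable_diff[OF f g(1)] hermite_coeff_diff_scale[OF f g(1), of 1] g(2) in auto)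
  then have "L2_norm_sq f = L2_norm_sq g"
    unfolding L2_norm_sq_def by (intro integral_cong_AE) (auto elim: eventually_mono)
  moreover have "(\<Sum>k. (cmod (hermite_coeff f k))\<^sup>2) \<le> L2_norm_sq f"
    by (rule suminf_le_const[OF sm]) (use bessel_inequality[OF f] in auto)
  ultimately show ?thesis
    using g(3) sm by (simp add: sums_iff)
qed

subsection \<open>Unitarity of the Bargmann transform\<close>

lemma bargmann_cong_AE:
  assumes "sq_integrable f" "sq_integrable g" "AE x in lborel. f x = g x"
  shows "bargmann f z = bargmann g z"
proof -
  have [measurable]: "f \<in> borel_measurable borel" "g \<in> borel_measurable borel"
    using assms by (auto simp: sq_integrable_def)
  show ?thesis
    unfolding bargmann_def using assms(3)
    by (intro integral_cong_AE) (auto elim: eventually_mono)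
qed

lemma bargmann_add:
  assumes "sq_integrable f" "sq_integrable g"
  shows "bargmann (\<lambda>x. f x + g x) z = bargmann f z + bargmann g z"
  unfolding bargmann_def ring_distribs
  by (intro Bochner_Integration.integral_add integrable_mult_sq_integrable
      sq_integrable_bargmann_kernel assms)

lemma bargmann_scale: "bargmann (\<lambda>x. a * f x) z = a * bargmann f z"
  unfolding bargmann_def by (simp add: mult.left_commute[of _ a])

lemma bargmann_kernel_mult_exp:
  "bargmann_kernel z x * exp (2 * of_real pi * of_real x * a)
    = exp (of_real pi * z * a + of_real pi * a\<^sup>2 / 2) * bargmann_kernel (z + a) x"
proof -
  have "- of_real pi * (of_real x)\<^sup>2 + 2 * of_real pi * of_real x * z - of_real pi * z\<^sup>2 / 2
        + 2 * of_real pi * of_real x * a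
      = (of_real pi * z * a + of_real pi * a\<^sup>2 / 2) + (- of_real pi * (of_real x)\<^sup>2
        + 2 * of_real pi * of_real x * (z + a) - of_real pi * (z + a)\<^sup>2 / 2)"
    by (simp add: power2_eq_square field_simps)
  then show ?thesis
    unfolding bargmann_kernel_def by (simp only: mult.assoc mult.left_commute[of _ "of_real (2 powr (1/4))"] exp_add[symmetric])
qed

lemma bargmann_mult_exp:
  "bargmann (\<lambda>x. exp (2 * of_real pi * of_real x * a) * f x) z
    = exp (of_real pi * z * a + of_real pi * a\<^sup>2 / 2) * bargmann f (z + a)"
  unfolding bargmann_def mult.assoc[symmetric] bargmann_kernel_mult_exp
  by (simp add: mult.assoc)

text \<open>Dilating by \<open>s\<close> multiplies the squared \<open>k\<close>-th Taylor
  coefficient by \<open>t ^ k\<close>, which adapts the transform from \<open>mu 1\<close> to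
  \<open>mu t\<close>: all factors in the norm formula cancel and Parseval's sum remains.\<close>

lemma nn_integral_bargmann:
  assumes f: "sq_integrable f" and s: "s \<noteq> 0" "(cmod s)\<^sup>2 = t"
  shows "(\<integral>\<^sup>+z. ennreal ((cmod (bargmann f (s * z)))\<^sup>2 * mu t z) \<partial>lborel) = ennreal (L2_norm_sq f)"
proof -
  have t: "t > 0" using s by auto
  define a where "a k = hermite_coeff f k * of_real (sqrt (pi ^ k / fact k)) * s ^ k" for k
  have "(\<lambda>k. a k * z ^ k) sums bargmann f (s * z)" for z
    using bargmann_sums[OF f, of "s * z"] by (simp add: a_def power_mult_distrib mult_ac)
  from nn_integral_entire_gaussian[OF t this]
  have "(\<integral>\<^sup>+z. ennreal ((cmod (bargmann f (s * z)))\<^sup>2 * mu t z) \<partial>lborel)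
      = (\<Sum>k. ennreal ((cmod (a k))\<^sup>2 * (fact k / (pi * t) ^ k)))" .
  also have "(\<lambda>k. (cmod (a k))\<^sup>2 * (fact k / (pi * t) ^ k)) = (\<lambda>k. (cmod (hermite_coeff f k))\<^sup>2)"
  proof
    fix k
    have "(cmod (a k))\<^sup>2 = (cmod (hermite_coeff f k))\<^sup>2 * (pi ^ k / fact k) * t ^ k"
      by (simp add: a_def norm_mult norm_power power_mult_distrib flip: s(2) power_mult)
        (simp add: mult.commute)
    then show "(cmod (a k))\<^sup>2 * (fact k / (pi * t) ^ k) = (cmod (hermite_coeff f k))\<^sup>2"
      using t by (simp add: power_mult_distrib)
  qed
  also have "(\<Sum>k. ennreal ((cmod (hermite_coeff f k))\<^sup>2)) = ennreal (L2_norm_sq f)"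
    by (intro suminf_ennreal_eq hermite_parseval f) auto
  finally show ?thesis .
qed

lemma bargmann_holomorphic:
  assumes f: "sq_integrable f"
  shows "bargmann f holomorphic_on UNIV"
proof -
  have "bargmann f holomorphic_on ball 0 r" for r
    by (rule power_series_holomorphic[where a = "\<lambda>k. hermite_coeff f k * of_real (sqrt (pi ^ k / fact k))"])
      (use bargmann_sums[OF f] in auto)
  then have "bargmann f field_differentiable (at w)" for w
    using holomorphic_on_imp_differentiable_at[of "bargmann f" "ball 0 (cmod w + 1)" w] by simp
  then show ?thesis
    by (simp add: holomorphic_on_def)
qed

lemma bargmann_in_HL2:
  assumes f: "sq_integrable f" and s: "s \<noteq> 0" "(cmod s)\<^sup>2 = t"
  shows "(\<lambda>z. bargmann f (s * z)) \<in> carrier (HL2 t)"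
    and "(LINT z|lborel. (cmod (bargmann f (s * z)))\<^sup>2 * mu t z) = L2_norm_sq f"
proof -
  have hol: "(\<lambda>z. bargmann f (s * z)) holomorphic_on UNIV"
    using holomorphic_on_compose[of "\<lambda>z. s * z" UNIV "bargmann f"]
      holomorphic_on_subset[OF bargmann_holomorphic[OF f]]
    by (auto simp: o_def intro: holomorphic_intros)
  have [measurable]: "(\<lambda>z. bargmann f (s * z)) \<in> borel_measurable borel"
    by (intro borel_measurable_continuous_onI holomorphic_on_imp_continuous_on hol)
  have [measurable]: "mu t \<in> borel_measurable borel"
    unfolding mu_def[abs_def] by measurable
  have mu0: "mu t z \<ge> 0" for z using s by (auto simp: mu_def)
  have int: "integrable lborel (\<lambda>z. (cmod (bargmann f (s * z)))\<^sup>2 * mu t z)"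
    by (rule integrableI_nonneg) (auto simp: nn_integral_bargmann[OF assms] mu0)
  then show "(\<lambda>z. bargmann f (s * z)) \<in> carrier (HL2 t)"
    using hol by (simp add: HL2_def)
  show "(LINT z|lborel. (cmod (bargmann f (s * z)))\<^sup>2 * mu t z) = L2_norm_sq f"
    using nn_integral_eq_integral[OF int] nn_integral_bargmann[OF assms]
    by (simp add: mu0 L2_norm_sq_nonneg Bochner_Integration.integral_nonneg)
qed

text \<open>Dividing the Taylor coefficients of \<open>F\<close> by the factors that the transform
  introduces gives the only possible Hermite coefficients. By the norm formula, their squares sum to
  the finite norm of \<open>F\<close>.\<close>

lemma bargmann_surj:
  assumes F: "F \<in> carrier (HL2 t)" and s: "s \<noteq> 0" "(cmod s)\<^sup>2 = t"
  obtains f where "sq_integrable f" "F = (\<lambda>z. bargmann f (s * z))"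
proof -
  have t: "t > 0" using s by auto
  have hol: "F holomorphic_on UNIV" and int: "integrable lborel (\<lambda>z. (cmod (F z))\<^sup>2 * mu t z)"
    using F by (auto simp: HL2_def)
  define a where "a k = (deriv ^^ k) F 0 / fact k" for k
  have sF: "(\<lambda>k. a k * z ^ k) sums F z" for z
    using holomorphic_power_series[of F 0 "cmod z + 1" z] holomorphic_on_subset[OF hol]
    by (simp add: a_def)
  define b where "b k = a k / (of_real (sqrt (pi ^ k / fact k)) * s ^ k)" for k
  have bk: "(cmod (b k))\<^sup>2 = (cmod (a k))\<^sup>2 * (fact k / (pi * t) ^ k)" for k
  proof -
    have "(cmod (of_real (sqrt (pi ^ k / fact k)) * s ^ k))\<^sup>2 = (pi ^ k / fact k) * t ^ k"
      by (simp add: norm_mult norm_power power_mult_distrib flip: s(2) power_mult)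
        (simp add: mult.commute)
    then show ?thesis
      by (simp add: b_def norm_divide power_divide power_mult_distrib)
  qed
  have "(\<Sum>k. ennreal ((cmod (b k))\<^sup>2)) = (\<integral>\<^sup>+z. ennreal ((cmod (F z))\<^sup>2 * mu t z) \<partial>lborel)"
    unfolding bk by (rule nn_integral_entire_gaussian[OF t sF, symmetric])
  also have "\<dots> = ennreal (LINT z|lborel. (cmod (F z))\<^sup>2 * mu t z)"
    using t by (intro nn_integral_eq_integral[OF int]) (auto simp: mu_def)
  finally have "summable (\<lambda>k. (cmod (b k))\<^sup>2)"
    by (intro summable_suminf_not_top) auto
  then obtain f where f: "sq_integrable f" "\<And>k. hermite_coeff f k = b k"
    using riesz_fischer_hermite by metis
  have "bargmann f (s * z) = F z" for z
  proof -
    have "b k * of_real (sqrt (pi ^ k / fact k)) * (s * z) ^ k = a k * z ^ k" for k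
      using s by (simp add: b_def power_mult_distrib)
    then show ?thesis
      using bargmann_sums[OF f(1), of "s * z"] sF[of z] by (simp add: f(2) sums_iff)
  qed
  with f(1) show thesis by (intro that) auto
qed

text \<open>The weight \<open>w\<close> lets one identity serve both spaces: it is
  \<open>mu t\<close> for entire functions and 1 on the line. Equality of norms thereby becomes
  equality of inner products.\<close>

lemma polarization_identity:
  fixes F G :: "'a \<Rightarrow> complex"
  assumes "\<And>c. c \<in> {1, -1, \<i>, -\<i>} \<Longrightarrow> integrable M (\<lambda>x. (cmod (F x + c * G x))\<^sup>2 * w x)"
  shows "(LINT x|M. F x * cnj (G x) * complex_of_real (w x))
    = (\<Sum>c\<in>{1, -1, \<i>, -\<i>}. c * of_real (LINT x|M. (cmod (F x + c * G x))\<^sup>2 * w x)) / 4"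
proof -
  have ne: "(1::complex) \<noteq> -1" "(1::complex) \<noteq> \<i>" "(1::complex) \<noteq> -\<i>" "-1 \<noteq> \<i>" "-1 \<noteq> -\<i>" "\<i> \<noteq> -\<i>"
    by (auto simp: complex_eq_iff)
  have pt: "F x * cnj (G x) * complex_of_real (w x)
      = (\<Sum>c\<in>{1, -1, \<i>, -\<i>}. c * of_real ((cmod (F x + c * G x))\<^sup>2 * w x)) / 4" for x
    unfolding of_real_mult complex_norm_square using ne by (simp add: algebra_simps)
  have i: "integrable M (\<lambda>x. c * complex_of_real ((cmod (F x + c * G x))\<^sup>2 * w x))"
    if "c \<in> {1, -1, \<i>, -\<i>}" for c
    using assms[OF that] by (intro integrable_mult_right) (simp del: of_real_mult of_real_power)
  show ?thesis
    unfolding pt integral_divide_zero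
    by (subst Bochner_Integration.integral_sum[OF i])
      (simp_all only: integral_mult_right_zero integral_complex_of_real)
qed

lemma L2_inner_bargmann:
  assumes f: "sq_integrable f" and g: "sq_integrable g" and s: "s \<noteq> 0" "(cmod s)\<^sup>2 = t"
  shows "inner_prod (HL2 t) (\<lambda>z. bargmann f (s * z)) (\<lambda>z. bargmann g (s * z))
    = (LINT x|lborel. f x * cnj (g x))"
proof -
  have sq: "sq_integrable (\<lambda>x. f x + c * g x)" for c
    by (intro sq_integrable_add sq_integrable_scale f g)
  have U: "bargmann f (s * z) + c * bargmann g (s * z) = bargmann (\<lambda>x. f x + c * g x) (s * z)" for c z
    by (simp add: bargmann_add f g sq_integrable_scale bargmann_scale)
  have "inner_prod (HL2 t) (\<lambda>z. bargmann f (s * z)) (\<lambda>z. bargmann g (s * z))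
      = (\<Sum>c\<in>{1, -1, \<i>, -\<i>}. c * of_real (LINT z|lborel. (cmod (bargmann f (s * z) + c * bargmann g (s * z)))\<^sup>2 * mu t z)) / 4"
    unfolding HL2_def inner_space.simps
    by (rule polarization_identity)
      (use bargmann_in_HL2(1)[OF sq s] in \<open>simp add: U HL2_def\<close>)
  also have "\<dots> = (\<Sum>c\<in>{1, -1, \<i>, -\<i>}. c * of_real (LINT x|lborel. (cmod (f x + c * g x))\<^sup>2 * 1)) / 4"
    unfolding U bargmann_in_HL2(2)[OF sq s] L2_norm_sq_def by simp
  also have "\<dots> = (LINT x|lborel. f x * cnj (g x) * complex_of_real 1)"
    by (rule polarization_identity[symmetric]) (use sq in \<open>auto simp: sq_integrable_def\<close>)
  finally show ?thesis by simp
qed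

subsection \<open>Classes modulo equality almost everywhere\<close>

lemma equiv_ae_rel: "equiv (Collect sq_integrable) ae_rel"
proof (rule equivI)
  show "trans ae_rel"
    by (rule transI) (auto simp: ae_rel_def elim: AE_mp)
qed (auto simp: ae_rel_def refl_on_def sym_def elim: AE_mp)

lemma ae_rel_class_eq_iff:
  "sq_integrable f \<Longrightarrow> sq_integrable g \<Longrightarrow>
    ae_rel `` {f} = ae_rel `` {g} \<longleftrightarrow> (AE x in lborel. f x = g x)"
  using eq_equiv_class_iff[OF equiv_ae_rel, of f g] by (simp add: ae_rel_def)

lemma L2_carrierE:
  assumes "A \<in> carrier L2"
  obtains f where "sq_integrable f" "A = ae_rel `` {f}"
  using assms by (auto simp: L2_def elim: quotientE)

lemma class_in_L2_carrier: "sq_integrable f \<Longrightarrow> ae_rel `` {f} \<in> carrier L2"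
  by (auto simp: L2_def intro: quotientI)

text \<open>The union over all representatives collapses because each of them contributes the same
  class.\<close>

lemma L2_lift_class:
  assumes "sq_integrable f" "\<And>g. (f, g) \<in> ae_rel \<Longrightarrow> ae_rel `` {\<Phi> g} = ae_rel `` {\<Phi> f}"
  shows "L2_lift \<Phi> (ae_rel `` {f}) = ae_rel `` {\<Phi> f}"
proof -
  have "f \<in> ae_rel `` {f}"
    by (rule equiv_class_self[OF equiv_ae_rel]) (simp add: assms)
  then show ?thesis
    unfolding L2_lift_def using assms(2) by blast
qed

lemma L2_plus_class:
  assumes f: "sq_integrable f" and g: "sq_integrable g"
  shows "plus L2 (ae_rel `` {f}) (ae_rel `` {g}) = ae_rel `` {\<lambda>x. f x + g x}"
proof -
  have "ae_rel `` {\<lambda>x. f' x + g' x} = ae_rel `` {\<lambda>x. f x + g x}"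
    if "(f, f') \<in> ae_rel" "(g, g') \<in> ae_rel" for f' g'
  proof -
    have "AE x in lborel. f' x + g' x = f x + g x"
      using that by (auto simp: ae_rel_def elim: AE_mp)
    then show ?thesis
      using that by (subst ae_rel_class_eq_iff) (auto simp: ae_rel_def intro: sq_integrable_add)
  qed
  moreover have "f \<in> ae_rel `` {f}" "g \<in> ae_rel `` {g}"
    by (auto intro!: equiv_class_self[OF equiv_ae_rel] simp: f g simp del: Image_singleton_iff)
  ultimately show ?thesis
    unfolding L2_def inner_space.simps by blast
qed

lemma L2_scale_class:
  assumes f: "sq_integrable f"
  shows "scale L2 a (ae_rel `` {f}) = ae_rel `` {\<lambda>x. a * f x}"
  unfolding L2_def inner_space.simps
proof (rule L2_lift_class[OF f])
  fix g assume g: "(f, g) \<in> ae_rel"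
  then have "AE x in lborel. g x = f x"
    by (auto simp: ae_rel_def elim: AE_mp)
  then have "AE x in lborel. a * g x = a * f x"
    by (rule AE_mp) simp
  moreover have "sq_integrable g"
    using g by (simp add: ae_rel_def)
  ultimately show "ae_rel `` {\<lambda>x. a * g x} = ae_rel `` {\<lambda>x. a * f x}"
    by (subst ae_rel_class_eq_iff) (auto intro: sq_integrable_scale f)
qed

lemma L2_inner_class:
  assumes f: "sq_integrable f" and g: "sq_integrable g"
  shows "inner_prod L2 (ae_rel `` {f}) (ae_rel `` {g}) = (LINT x|lborel. f x * cnj (g x))"
proof -
  have "(LINT x|lborel. f' x * cnj (g' x)) = (LINT x|lborel. f x * cnj (g x))"
    if "(f, f') \<in> ae_rel" "(g, g') \<in> ae_rel" for f' g'
  proof (rule integral_cong_AE)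
    show "AE x in lborel. f' x * cnj (g' x) = f x * cnj (g x)"
      using that by (auto simp: ae_rel_def elim: AE_mp)
    have "(\<lambda>x. u x * cnj (v x)) \<in> borel_measurable lborel" if "sq_integrable u" "sq_integrable v" for u v
      by (rule borel_measurable_integrable, intro integrable_mult_sq_integrable sq_integrable_cnj that)
    then show "(\<lambda>x. f' x * cnj (g' x)) \<in> borel_measurable lborel" "(\<lambda>x. f x * cnj (g x)) \<in> borel_measurable lborel"
      using that f g by (simp_all only: ae_rel_def mem_Collect_eq prod.case)
  qed
  moreover have "f \<in> ae_rel `` {f}" "g \<in> ae_rel `` {g}"
    by (auto intro!: equiv_class_self[OF equiv_ae_rel] simp: f g simp del: Image_singleton_iff)
  ultimately have "(\<Union>f\<in>ae_rel `` {f}. \<Union>g\<in>ae_rel `` {g}. {LINT x|lborel. f x * cnj (g x)})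
      = {LINT x|lborel. f x * cnj (g x)}"
    by blast
  then show ?thesis
    unfolding L2_def inner_space.simps by simp
qed

text \<open>Multiplication by an unbounded \<open>w\<close> may leave the space, hence the
  assumption on the product; it passes from \<open>f\<close> to every other representative.\<close>

lemma mult_op_class:
  assumes f: "sq_integrable f" and [measurable]: "w \<in> borel_measurable borel"
    and wf: "sq_integrable (\<lambda>x. complex_of_real (w x) * f x)"
  shows "mult_op w (ae_rel `` {f}) = ae_rel `` {\<lambda>x. complex_of_real (w x) * f x}"
  unfolding mult_op_def
proof (rule L2_lift_class[OF f])
  fix g assume g: "(f, g) \<in> ae_rel"
  have [measurable]: "f \<in> borel_measurable borel" "g \<in> borel_measurable borel"
    using g by (auto simp: ae_rel_def sq_integrable_def)
  have ae: "AE x in lborel. complex_of_real (w x) * g x = complex_of_real (w x) * f x"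
    using g by (auto simp: ae_rel_def elim: AE_mp)
  have "integrable lborel (\<lambda>x. (cmod (complex_of_real (w x) * g x))\<^sup>2)"
    using wf ae
    by (subst integrable_cong_AE[where g = "\<lambda>x. (cmod (complex_of_real (w x) * f x))\<^sup>2"])
      (auto simp: sq_integrable_def elim: AE_mp)
  then have "sq_integrable (\<lambda>x. complex_of_real (w x) * g x)"
    by (simp add: sq_integrable_def)
  then show "ae_rel `` {\<lambda>x. complex_of_real (w x) * g x} = ae_rel `` {\<lambda>x. complex_of_real (w x) * f x}"
    using ae wf by (subst ae_rel_class_eq_iff) auto
qed

text \<open>Changing \<open>f\<close> on a null set changes the integral at no \<open>x\<close>, so
  all representatives have literally the same image.\<close>

lemma integral_op_class:
  assumes f: "sq_integrable f" and [measurable]: "\<And>x. k x \<in> borel_measurable borel"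
  shows "integral_op k (ae_rel `` {f}) = ae_rel `` {\<lambda>x. LINT y|lborel. complex_of_real (k x y) * f y}"
  unfolding integral_op_def
proof (rule L2_lift_class[OF f])
  fix g assume g: "(f, g) \<in> ae_rel"
  have [measurable]: "f \<in> borel_measurable borel" "g \<in> borel_measurable borel"
    using g by (auto simp: ae_rel_def sq_integrable_def)
  have "(LINT y|lborel. complex_of_real (k x y) * g y) = (LINT y|lborel. complex_of_real (k x y) * f y)" for x
    using g by (intro integral_cong_AE) (auto simp: ae_rel_def elim: AE_mp)
  then show "ae_rel `` {\<lambda>x. LINT y|lborel. complex_of_real (k x y) * g y}
      = ae_rel `` {\<lambda>x. LINT y|lborel. complex_of_real (k x y) * f y}"
    by simp
qed

subsection \<open>The Kac operator and the intertwining relation\<close>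

definition kac_transform :: "real \<Rightarrow> (real \<Rightarrow> complex) \<Rightarrow> real \<Rightarrow> complex" where
  "kac_transform \<gamma> f x = (LINT y|lborel. complex_of_real (kac_kernel \<gamma> x y) * f y)"

definition kac_eigenvalue :: "real \<Rightarrow> nat \<Rightarrow> real" where
  "kac_eigenvalue \<gamma> k = 2 * exp (- (real k + 1/2) * \<gamma>)"

lemma kac_eigenvalue_eq: "kac_eigenvalue \<gamma> k = 2 * exp (- \<gamma> / 2) * exp (- \<gamma>) ^ k"
  by (simp add: kac_eigenvalue_def algebra_simps flip: exp_add exp_of_nat_mult)

text \<open>The eigenvalues decay like \<open>exp (- \<gamma>) ^ k\<close>. Half of the rate pays
  for the division, the other half for summability.\<close>

lemma summable_kac_eigenvalue:
  assumes "\<gamma> > 0" "\<And>k. cmod (b k) \<le> B"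
  shows "summable (\<lambda>k. cmod (of_real (kac_eigenvalue \<gamma> k) * b k) / exp (- \<gamma> / 2) ^ k)"
proof (rule summable_comparison_test')
  have "exp (- \<gamma> / 2) < 1" using assms(1) by simp
  then show "summable (\<lambda>k. 2 * exp (- \<gamma> / 2) * B * exp (- \<gamma> / 2) ^ k)"
    by (intro summable_mult summable_geometric) simp
  fix k
  have "exp (- \<gamma>) = exp (- \<gamma> / 2) * exp (- \<gamma> / 2)"
    by (simp flip: exp_add)
  then have "kac_eigenvalue \<gamma> k / exp (- \<gamma> / 2) ^ k = 2 * exp (- \<gamma> / 2) * exp (- \<gamma> / 2) ^ k"
    by (simp add: kac_eigenvalue_eq power_mult_distrib)
  moreover have "kac_eigenvalue \<gamma> k \<ge> 0" by (simp add: kac_eigenvalue_def)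
  then have "norm (cmod (of_real (kac_eigenvalue \<gamma> k) * b k) / exp (- \<gamma> / 2) ^ k)
      = kac_eigenvalue \<gamma> k / exp (- \<gamma> / 2) ^ k * cmod (b k)"
    by (simp add: norm_mult)
  ultimately have "norm (cmod (of_real (kac_eigenvalue \<gamma> k) * b k) / exp (- \<gamma> / 2) ^ k)
      = 2 * exp (- \<gamma> / 2) * exp (- \<gamma> / 2) ^ k * cmod (b k)"
    by (simp only:)
  also have "\<dots> \<le> 2 * exp (- \<gamma> / 2) * exp (- \<gamma> / 2) ^ k * B"
    by (intro mult_left_mono assms) auto
  finally show "norm (cmod (of_real (kac_eigenvalue \<gamma> k) * b k) / exp (- \<gamma> / 2) ^ k)
      \<le> 2 * exp (- \<gamma> / 2) * B * exp (- \<gamma> / 2) ^ k"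
    by (simp add: mult_ac)
qed

text \<open>With \<open>r = exp (- \<gamma> / 4)\<close> the eigenvalues decay like
  \<open>r ^ (4 * k)\<close>. One factor \<open>r ^ k\<close> pays for the division, one for the
  possible growth of \<open>hermite k x\<close>, and the remaining two give summability.\<close>

lemma summable_kac_eigenvalue_hermite:
  assumes "\<gamma> > 0"
  obtains r where "0 < r" "r < 1"
    "\<And>x. summable (\<lambda>k. cmod (of_real (kac_eigenvalue \<gamma> k * hermite k x)) / r ^ k)"
proof -
  define r where "r = exp (- \<gamma> / 4)"
  have r: "0 < r" "r < 1" using assms by (auto simp: r_def)
  have r2: "exp (- (\<gamma> / 2) / 2) = r" "exp (- (\<gamma> / 2)) = r * r" "exp (- \<gamma> / 2) = r * r"
    "exp (- \<gamma>) = (r * r) * (r * r)"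
    by (simp_all add: r_def flip: exp_add)
  have "summable (\<lambda>k. cmod (of_real (kac_eigenvalue \<gamma> k) / of_real (r ^ k)) / exp (- (\<gamma> / 2) / 2) ^ k)"
  proof -
    have "(\<lambda>k. cmod (of_real (kac_eigenvalue \<gamma> k) / of_real (r ^ k)) / exp (- (\<gamma> / 2) / 2) ^ k)
        = (\<lambda>k. 2 * exp (- \<gamma> / 2) * exp (- (\<gamma> / 2)) ^ k)"
    proof
      fix k
      have "kac_eigenvalue \<gamma> k = 2 * exp (- \<gamma> / 2) * (r ^ k * r ^ k * (r ^ k * r ^ k))"
        by (simp add: kac_eigenvalue_eq r2 power_mult_distrib)
      then show "cmod (of_real (kac_eigenvalue \<gamma> k) / of_real (r ^ k)) / exp (- (\<gamma> / 2) / 2) ^ k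
          = 2 * exp (- \<gamma> / 2) * exp (- (\<gamma> / 2)) ^ k"
        using r unfolding r2 power_mult_distrib by (simp add: norm_divide norm_mult norm_power)
    qed
    moreover have "exp (- (\<gamma> / 2)) < 1" using assms by simp
    ultimately show ?thesis
      by (simp only:) (intro summable_mult summable_geometric, simp)
  qed
  then have sm: "summable (\<lambda>k. cmod (of_real (kac_eigenvalue \<gamma> k) / of_real (r ^ k)) / r ^ k)"
    by (simp add: r_def)
  have "summable (\<lambda>k. cmod (of_real (kac_eigenvalue \<gamma> k) / of_real (r ^ k) * of_real (hermite k x)))" for x
    using hermite_series_gaussian_bound[OF r sm] by blast
  then have "summable (\<lambda>k. cmod (of_real (kac_eigenvalue \<gamma> k * hermite k x)) / r ^ k)" for x
    using r by (simp add: norm_mult norm_divide norm_power)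
  with r show thesis by (rule that)
qed

lemma kac_kernel_sums:
  assumes "\<gamma> > 0"
  shows "(\<lambda>k. kac_eigenvalue \<gamma> k * hermite k x * hermite k y) sums kac_kernel \<gamma> x y"
proof -
  obtain r where r: "0 < r" "r < 1"
    "\<And>x. summable (\<lambda>k. cmod (of_real (kac_eigenvalue \<gamma> k * hermite k x)) / r ^ k)"
    using summable_kac_eigenvalue_hermite[OF assms] by blast
  have "summable (\<lambda>k. cmod (of_real (kac_eigenvalue \<gamma> k * hermite k x) * of_real (hermite k y)))"
    using hermite_series_gaussian_bound[OF r(1,2) r(3)] by blast
  then have "summable (\<lambda>k. norm (kac_eigenvalue \<gamma> k * hermite k x * hermite k y))"
    by (simp add: norm_mult abs_mult)
  then have s: "summable (\<lambda>k. kac_eigenvalue \<gamma> k * hermite k x * hermite k y)"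
    by (rule summable_norm_cancel)
  then have "summable (\<lambda>k. exp (- (real k + 1/2) * \<gamma>) * hermite k x * hermite k y)"
    using summable_mult[of "\<lambda>k. kac_eigenvalue \<gamma> k * hermite k x * hermite k y" "1/2"]
    by (simp add: kac_eigenvalue_def mult.assoc)
  from suminf_mult[OF this, of 2] have "kac_kernel \<gamma> x y = (\<Sum>k. kac_eigenvalue \<gamma> k * hermite k x * hermite k y)"
    by (simp add: kac_kernel_def kac_eigenvalue_def mult.assoc)
  with s show ?thesis by (simp add: sums_iff)
qed

lemma borel_measurable_kac_kernel:
  assumes "\<gamma> > 0"
  shows "kac_kernel \<gamma> x \<in> borel_measurable borel"
proof -
  have "kac_kernel \<gamma> x = (\<lambda>y. \<Sum>k. kac_eigenvalue \<gamma> k * hermite k x * hermite k y)"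
    using kac_kernel_sums[OF assms] by (auto simp: sums_iff)
  then show ?thesis by simp
qed

text \<open>For fixed \<open>x\<close> the kernel is a Hermite series in \<open>y\<close>, whose
  weights contain \<open>hermite k x\<close>; it is paired with \<open>f\<close>.\<close>

lemma kac_transform_sums:
  assumes \<gamma>: "\<gamma> > 0" and f: "sq_integrable f"
  shows "(\<lambda>k. of_real (kac_eigenvalue \<gamma> k) * hermite_coeff f k * of_real (hermite k x)) sums kac_transform \<gamma> f x"
proof -
  obtain r where r: "0 < r" "r < 1"
    "\<And>x. summable (\<lambda>k. cmod (of_real (kac_eigenvalue \<gamma> k * hermite k x)) / r ^ k)"
    using summable_kac_eigenvalue_hermite[OF \<gamma>] by blast
  have "complex_of_real (kac_kernel \<gamma> x y) = (\<Sum>k. of_real (kac_eigenvalue \<gamma> k * hermite k x) * of_real (hermite k y))" for y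
    using sums_of_real[OF kac_kernel_sums[OF \<gamma>, of x y], where 'a = complex] by (simp add: sums_iff)
  then show ?thesis
    using hermite_series_pairing[OF r(1,2) r(3) f, of x] by (simp add: kac_transform_def mult_ac)
qed

text \<open>Bessel bounds the coefficients of \<open>f\<close>, so the image is a Hermite series
  whose weights decay as fast as the eigenvalues. Pairing this series with a single Hermite function
  isolates one coefficient.\<close>

lemma kac_transform_properties:
  assumes \<gamma>: "\<gamma> > 0" and f: "sq_integrable f"
  shows kac_transform_measurable: "kac_transform \<gamma> f \<in> borel_measurable borel"
    and kac_transform_bound: "\<exists>C>0. \<exists>d>0. \<forall>x. cmod (kac_transform \<gamma> f x) \<le> C * exp (- d * x\<^sup>2)"
    and sq_integrable_kac_transform: "sq_integrable (kac_transform \<gamma> f)"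
    and hermite_coeff_kac_transform:
      "hermite_coeff (kac_transform \<gamma> f) j = of_real (kac_eigenvalue \<gamma> j) * hermite_coeff f j"
proof -
  define w where "w k = of_real (kac_eigenvalue \<gamma> k) * hermite_coeff f k" for k
  have "cmod (hermite_coeff f k) \<le> sqrt (L2_norm_sq f)" for k
    using bessel_inequality[OF f, of "{k}"] by (intro real_le_rsqrt) simp
  from summable_kac_eigenvalue[OF \<gamma>, of "hermite_coeff f", OF this]
  have w: "summable (\<lambda>k. cmod (w k) / exp (- \<gamma> / 2) ^ k)"
    by (simp add: w_def)
  have r: "0 < exp (- \<gamma> / 2)" "exp (- \<gamma> / 2) < 1" using \<gamma> by auto
  have K: "kac_transform \<gamma> f x = (\<Sum>k. w k * of_real (hermite k x))" for x
    using kac_transform_sums[OF \<gamma> f, of x] by (simp add: sums_iff w_def)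
  have Kfun: "kac_transform \<gamma> f = (\<lambda>x. \<Sum>k. w k * of_real (hermite k x))"
    by (rule ext) (rule K)
  show m: "kac_transform \<gamma> f \<in> borel_measurable borel"
    unfolding Kfun by measurable
  obtain C d where Cd: "C > 0" "d > 0" "\<And>x. summable (\<lambda>k. cmod (w k * of_real (hermite k x)))"
    "\<And>x. cmod (\<Sum>k. w k * of_real (hermite k x)) \<le> C * exp (- d * x\<^sup>2)"
    using hermite_series_gaussian_bound[OF r w] by blast
  then have C: "C > 0" "d > 0" "\<And>x. cmod (kac_transform \<gamma> f x) \<le> C * exp (- d * x\<^sup>2)"
    by (simp_all only: K)
  then show "\<exists>C>0. \<exists>d>0. \<forall>x. cmod (kac_transform \<gamma> f x) \<le> C * exp (- d * x\<^sup>2)"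
    by blast
  show "sq_integrable (kac_transform \<gamma> f)"
    by (rule sq_integrable_dominated[OF sq_integrable_gaussian[OF C(2), of C] m])
      (use C in \<open>simp add: norm_mult\<close>)
  have "(\<lambda>k. w k * hermite_coeff (\<lambda>x. of_real (hermite j x)) k) sums
      (LINT x|lborel. kac_transform \<gamma> f x * of_real (hermite j x))"
    unfolding K by (rule hermite_series_pairing[OF r w sq_integrable_hermite])
  moreover have "(\<lambda>k. w k * hermite_coeff (\<lambda>x. of_real (hermite j x)) k) sums w j"
  proof -
    have "(\<lambda>k. w k * hermite_coeff (\<lambda>x. of_real (hermite j x)) k) = (\<lambda>k. if k = j then w k else 0)"
      by (auto simp: hermite_orthonormal)
    then show ?thesis using sums_single[of j w] by simp
  qed
  ultimately show "hermite_coeff (kac_transform \<gamma> f) j = of_real (kac_eigenvalue \<gamma> j) * hermite_coeff f j"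
    by (auto simp: hermite_coeff_def w_def mult.commute dest: sums_unique2)
qed

lemma bargmann_kac_transform:
  assumes \<gamma>: "\<gamma> > 0" and f: "sq_integrable f"
  shows "bargmann (kac_transform \<gamma> f) z = of_real (2 * exp (- \<gamma> / 2)) * bargmann f (of_real (exp (- \<gamma>)) * z)"
proof -
  have "(\<lambda>k. hermite_coeff (kac_transform \<gamma> f) k * of_real (sqrt (pi ^ k / fact k)) * z ^ k)
      sums bargmann (kac_transform \<gamma> f) z"
    by (intro bargmann_sums sq_integrable_kac_transform assms)
  moreover have "(\<lambda>k. hermite_coeff (kac_transform \<gamma> f) k * of_real (sqrt (pi ^ k / fact k)) * z ^ k)
      sums (of_real (2 * exp (- \<gamma> / 2)) * bargmann f (of_real (exp (- \<gamma>)) * z))"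
    using sums_mult[OF bargmann_sums[OF f, of "of_real (exp (- \<gamma>)) * z"], of "of_real (2 * exp (- \<gamma> / 2))"]
    unfolding hermite_coeff_kac_transform[OF assms] kac_eigenvalue_eq of_real_mult of_real_power power_mult_distrib
    by (simp add: mult_ac)
  ultimately show ?thesis by (rule sums_unique2)
qed

section \<open>The weight and its action through the Bargmann transform\<close>

lemma borel_measurable_cosh_weight[measurable]: "cosh_weight \<beta> \<in> borel_measurable borel"
  unfolding cosh_weight_def[abs_def]
  by (cases "\<beta> \<ge> 0") (auto intro!: borel_measurable_continuous_onI continuous_intros)

lemma abs_cosh_weight_le: "\<bar>cosh_weight \<beta> x\<bar> \<le> exp (2 * sqrt (\<bar>\<beta>\<bar> * pi) * \<bar>x\<bar>)"
proof (cases "\<beta> \<ge> 0")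
  case True
  define a where "a = 2 * sqrt (\<beta> * pi)"
  have "a \<ge> 0" using True by (simp add: a_def)
  then have "exp (a * x) \<le> exp (a * \<bar>x\<bar>)" "exp (- (a * x)) \<le> exp (a * \<bar>x\<bar>)"
    by (auto simp: abs_if mult_le_0_iff zero_le_mult_iff)
  then have "cosh (a * x) \<le> exp (a * \<bar>x\<bar>)"
    using add_mono[of "exp (a * x)" "exp (a * \<bar>x\<bar>)" "exp (- (a * x))" "exp (a * \<bar>x\<bar>)"]
    by (simp add: cosh_field_def del: exp_le_cancel_iff)
  moreover have "cosh (a * x) \<ge> 0" using cosh_real_pos[of "a * x"] by simp
  ultimately show ?thesis using True by (simp add: cosh_weight_def a_def)
next
  case False
  have "\<bar>cos (2 * sqrt (\<bar>\<beta>\<bar> * pi) * x)\<bar> \<le> 1" by simp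
  also have "1 \<le> exp (2 * sqrt (\<bar>\<beta>\<bar> * pi) * \<bar>x\<bar>)" by simp
  finally show ?thesis using False by (simp add: cosh_weight_def)
qed

lemma sq_integrable_cosh_weight_kac_transform:
  assumes \<gamma>: "\<gamma> > 0" and f: "sq_integrable f"
  shows "sq_integrable (\<lambda>x. of_real (cosh_weight \<beta> x) * kac_transform \<gamma> f x)"
proof -
  note [measurable] = kac_transform_measurable[OF assms]
  obtain C d where C: "C > 0" "d > 0" "\<And>x. cmod (kac_transform \<gamma> f x) \<le> C * exp (- d * x\<^sup>2)"
    using kac_transform_bound[OF assms] by blast
  define a where "a = 2 * sqrt (\<bar>\<beta>\<bar> * pi)"
  define D where "D = C * exp (a\<^sup>2 / (2 * d))"
  show ?thesis
  proof (rule sq_integrable_dominated)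
    show "sq_integrable (\<lambda>x. of_real (D * exp (- (d / 2) * x\<^sup>2)))"
      by (rule sq_integrable_gaussian) (use C in simp)
    fix x
    \<comment> \<open>The exponential growth of the weight costs half of the Gaussian rate
      \<open>d\<close>, and the factor \<open>exp (a\<^sup>2 / (2 * d))\<close> in
      \<open>D\<close>.\<close>
    have "0 \<le> (d * \<bar>x\<bar> - a)\<^sup>2 / (2 * d)" using C by simp
    also have "\<dots> = d / 2 * x\<^sup>2 - a * \<bar>x\<bar> + a\<^sup>2 / (2 * d)"
      using C by (simp add: power2_eq_square field_simps)
    finally have le: "a * \<bar>x\<bar> + - d * x\<^sup>2 \<le> a\<^sup>2 / (2 * d) + - (d / 2) * x\<^sup>2"
      by simp
    have "cmod (of_real (cosh_weight \<beta> x) * kac_transform \<gamma> f x) \<le> exp (a * \<bar>x\<bar>) * (C * exp (- d * x\<^sup>2))"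
      unfolding norm_mult norm_of_real a_def by (intro mult_mono abs_cosh_weight_le C) auto
    also have "\<dots> = C * exp (a * \<bar>x\<bar> + - d * x\<^sup>2)"
      by (simp only: exp_add mult_ac)
    also have "\<dots> \<le> C * exp (a\<^sup>2 / (2 * d) + - (d / 2) * x\<^sup>2)"
      using C le by (intro mult_left_mono) auto
    also have "\<dots> = D * exp (- (d / 2) * x\<^sup>2)"
      by (simp only: D_def exp_add mult_ac)
    also have "\<dots> = cmod (of_real (D * exp (- (d / 2) * x\<^sup>2)))"
      using C by (simp add: D_def norm_mult)
    finally show "cmod (of_real (cosh_weight \<beta> x) * kac_transform \<gamma> f x) \<le> cmod (of_real (D * exp (- (d / 2) * x\<^sup>2)))" .
  qed measurable
qed

text \<open>For \<open>\<beta> < 0\<close> the Bargmann transform is precomposed with a quarter turn. This makes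
  \<open>pi * s\<^sup>2 = \<beta>\<close> for both signs, and the two cases can be treated together.\<close>

definition bargmann_scaling :: "real \<Rightarrow> complex" where
  "bargmann_scaling \<beta> = (if \<beta> \<ge> 0 then of_real (sqrt (\<beta> / pi)) else \<i> * of_real (sqrt (\<bar>\<beta>\<bar> / pi)))"

lemma bargmann_scaling:
  assumes "\<beta> \<noteq> 0"
  shows "bargmann_scaling \<beta> \<noteq> 0" "(cmod (bargmann_scaling \<beta>))\<^sup>2 = \<bar>\<beta>\<bar> / pi"
    "of_real pi * (bargmann_scaling \<beta>)\<^sup>2 = of_real \<beta>"
proof -
  have b: "(sqrt (\<bar>\<beta>\<bar> / pi))\<^sup>2 = \<bar>\<beta>\<bar> / pi" by simp
  show "bargmann_scaling \<beta> \<noteq> 0" "(cmod (bargmann_scaling \<beta>))\<^sup>2 = \<bar>\<beta>\<bar> / pi"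
    using assms b by (auto simp: bargmann_scaling_def norm_mult divide_le_0_iff)
  have "(bargmann_scaling \<beta>)\<^sup>2 = of_real (\<beta> / pi)"
  proof (cases "\<beta> \<ge> 0")
    case False
    then have "(bargmann_scaling \<beta>)\<^sup>2 = - of_real ((sqrt (\<bar>\<beta>\<bar> / pi))\<^sup>2)"
      by (simp add: bargmann_scaling_def power_mult_distrib)
    then show ?thesis
      using False unfolding b by simp
  qed (use b in \<open>simp add: bargmann_scaling_def flip: of_real_power\<close>)
  then show "of_real pi * (bargmann_scaling \<beta>)\<^sup>2 = of_real \<beta>"
    by simp
qed

text \<open>\<open>2 * pi * s * x\<close> with \<open>s = bargmann_scaling \<beta>\<close> is the
  argument of the cosh, real for \<open>\<beta> \<ge> 0\<close>. For \<open>\<beta> < 0\<close> it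
  is imaginary, and the same mean of exponentials is the cosine.\<close>

lemma cosh_weight_eq_exp:
  "complex_of_real (cosh_weight \<beta> x) = (exp (2 * of_real pi * of_real x * bargmann_scaling \<beta>)
    + exp (2 * of_real pi * of_real x * (- bargmann_scaling \<beta>))) / 2"
proof -
  define a where "a = sqrt (\<bar>\<beta>\<bar> * pi)"
  have a: "pi * sqrt (\<bar>\<beta>\<bar> / pi) = a"
    unfolding a_def by (simp add: real_sqrt_divide real_sqrt_mult field_simps)
  show ?thesis
  proof (cases "\<beta> \<ge> 0")
    case True
    then have eq: "2 * of_real pi * of_real x * bargmann_scaling \<beta> = complex_of_real (2 * a * x)"
      by (simp add: bargmann_scaling_def flip: a)
    have cosh: "cosh_weight \<beta> x = (exp (2 * a * x) + exp (- (2 * a * x))) / 2"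
      using True by (simp add: cosh_weight_def cosh_field_def a_def)
    show ?thesis
      unfolding mult_minus_right eq cosh
      by (simp only: of_real_divide of_real_add exp_of_real[symmetric] of_real_minus of_real_numeral)
  next
    case False
    then have eq: "2 * of_real pi * of_real x * bargmann_scaling \<beta> = \<i> * complex_of_real (2 * a * x)"
      by (simp add: bargmann_scaling_def flip: a)
    have cos: "cosh_weight \<beta> x = cos (2 * a * x)"
      using False by (simp add: cosh_weight_def a_def)
    show ?thesis
      unfolding mult_minus_right eq cos cos_of_real[symmetric] cos_exp_eq by simp
  qed
qed

text \<open>The exponentials in the weight translate by \<open>s\<close> and \<open>- s\<close>,
  which after factoring out \<open>s\<close> are translations by 1 and -1. Since
  \<open>pi * s\<^sup>2 = \<beta>\<close>, both produce the same constant
  \<open>exp (\<beta> / 2)\<close>, so a single prefactor normalizes both terms.\<close>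

lemma bargmann_ruelle:
  assumes \<gamma>: "\<gamma> > 0" and l: "l = exp (- \<gamma>)" and \<beta>: "\<beta> \<noteq> 0" and f: "sq_integrable f"
  defines "s \<equiv> bargmann_scaling \<beta>"
  shows "bargmann (\<lambda>x. complex_of_real (1 / sqrt (l * exp \<beta>)) * (of_real (cosh_weight \<beta> x) * kac_transform \<gamma> f x)) (s * z)
    = ruelle l \<beta> (\<lambda>z. bargmann f (s * z)) z"
proof -
  define K where "K = kac_transform \<gamma> f"
  define E where "E a x = exp (2 * of_real pi * of_real x * a) * K x" for a :: complex and x :: real
  have s2: "of_real pi * s\<^sup>2 = of_real \<beta>" unfolding s_def by (rule bargmann_scaling) fact
  have EU: "bargmann (E a) (s * z) = exp (of_real pi * (s * z) * a + of_real pi * a\<^sup>2 / 2)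
      * (of_real (2 * exp (- \<gamma> / 2)) * bargmann f (of_real l * (s * z + a)))" for a
    unfolding E_def bargmann_mult_exp K_def bargmann_kac_transform[OF \<gamma> f] l ..
  \<comment> \<open>The exponential is moved from \<open>K x\<close> onto the kernel, which it
    merely translates up to a constant.\<close>
  have iE: "integrable lborel (\<lambda>x. bargmann_kernel (s * z) x * E a x)" for a
  proof -
    have "integrable lborel (\<lambda>x. exp (of_real pi * (s * z) * a + of_real pi * a\<^sup>2 / 2) * (bargmann_kernel (s * z + a) x * K x))"
      unfolding K_def
      by (intro integrable_mult_right integrable_mult_sq_integrable sq_integrable_bargmann_kernel
          sq_integrable_kac_transform \<gamma> f)
    then show ?thesis
      unfolding E_def mult.assoc[symmetric] bargmann_kernel_mult_exp .
  qed
  have "bargmann (\<lambda>x. of_real (cosh_weight \<beta> x) * K x) (s * z)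
      = (LINT x|lborel. (bargmann_kernel (s * z) x * E s x + bargmann_kernel (s * z) x * E (- s) x) / 2)"
    unfolding bargmann_def cosh_weight_eq_exp E_def s_def
    by (intro Bochner_Integration.integral_cong refl) (simp add: algebra_simps add_divide_distrib)
  also have "\<dots> = (bargmann (E s) (s * z) + bargmann (E (- s)) (s * z)) / 2"
    by (simp add: iE bargmann_def)
  also have "bargmann (E s) (s * z) = exp (of_real \<beta> / 2) * of_real (2 * exp (- \<gamma> / 2)) *
      (exp (of_real \<beta> * z) * bargmann f (s * (of_real l + of_real l * z)))"
  proof -
    have "of_real pi * (s * z) * s + of_real pi * s\<^sup>2 / 2 = of_real \<beta> * z + of_real \<beta> / 2"
      by (simp add: power2_eq_square flip: s2)
    then show ?thesis
      unfolding EU by (simp only: exp_add) (simp add: algebra_simps)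
  qed
  also have "bargmann (E (- s)) (s * z) = exp (of_real \<beta> / 2) * of_real (2 * exp (- \<gamma> / 2)) *
      (exp (- of_real \<beta> * z) * bargmann f (s * (- of_real l + of_real l * z)))"
  proof -
    have "of_real pi * (s * z) * (- s) + of_real pi * (- s)\<^sup>2 / 2 = - of_real \<beta> * z + of_real \<beta> / 2"
      by (simp add: power2_eq_square flip: s2)
    then show ?thesis
      unfolding EU by (simp only: exp_add) (simp add: algebra_simps)
  qed
  finally have "bargmann (\<lambda>x. of_real (cosh_weight \<beta> x) * K x) (s * z)
      = exp (of_real \<beta> / 2) * of_real (exp (- \<gamma> / 2)) * ruelle l \<beta> (\<lambda>z. bargmann f (s * z)) z"
    by (simp add: ruelle_def algebra_simps add_divide_distrib)
  moreover have "complex_of_real (1 / sqrt (l * exp \<beta>)) * (exp (of_real \<beta> / 2) * of_real (exp (- \<gamma> / 2))) = 1"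
  proof -
    have "sqrt (l * exp \<beta>) = exp (- \<gamma> / 2) * exp (\<beta> / 2)"
      unfolding l real_sqrt_mult by (intro arg_cong2[where f = "(*)"] real_sqrt_unique) (simp_all flip: exp_double)
    then have "1 / sqrt (l * exp \<beta>) * (exp (\<beta> / 2) * exp (- \<gamma> / 2)) = 1"
      by simp
    then have "complex_of_real (1 / sqrt (l * exp \<beta>) * (exp (\<beta> / 2) * exp (- \<gamma> / 2))) = 1"
      by (simp only: of_real_1)
    then show ?thesis
      by (simp only: of_real_mult exp_of_real[symmetric] of_real_divide of_real_numeral)
  qed
  ultimately show ?thesis
    unfolding bargmann_scale K_def[symmetric] by (simp only: mult.assoc[symmetric] mult_1)
qed

theorem proposition4p8:
  fixes \<gamma> l c \<beta> :: real
  assumes "\<gamma> > 0" and "l = exp (- \<gamma>)" and "c = 2 * sqrt pi" and "\<beta> \<noteq> 0"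
  shows "conjugate_operators
           (HL2 (\<bar>\<beta>\<bar> / pi)) (ruelle l \<beta>)
           L2 (scale L2 (complex_of_real (1 / sqrt (l * exp \<beta>))) \<circ>
               (mult_op (cosh_weight \<beta>) \<circ> integral_op (kac_kernel \<gamma>)))"
proof -
  define t where "t = \<bar>\<beta>\<bar> / pi"
  define s where "s = bargmann_scaling \<beta>"
  have s: "s \<noteq> 0" "(cmod s)\<^sup>2 = t"
    using bargmann_scaling[OF assms(4)] by (simp_all add: s_def t_def)
  define T where "T = scale L2 (complex_of_real (1 / sqrt (l * exp \<beta>))) \<circ>
               (mult_op (cosh_weight \<beta>) \<circ> integral_op (kac_kernel \<gamma>))"
  define T' where "T' f x = complex_of_real (1 / sqrt (l * exp \<beta>)) *
    (of_real (cosh_weight \<beta> x) * kac_transform \<gamma> f x)" for f x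
  \<comment> \<open>The choice of the representative is immaterial, because the transform ignores
    null sets.\<close>
  define U where "U A z = bargmann (SOME f. f \<in> A) (s * z)" for A z
  have T'sq: "sq_integrable (T' f)" if "sq_integrable f" for f
    unfolding T'_def
    by (intro sq_integrable_scale sq_integrable_cosh_weight_kac_transform assms that)
  have T: "T (ae_rel `` {f}) = ae_rel `` {T' f}" if f: "sq_integrable f" for f
  proof -
    have "integral_op (kac_kernel \<gamma>) (ae_rel `` {f}) = ae_rel `` {kac_transform \<gamma> f}"
      unfolding kac_transform_def
      by (intro integral_op_class f borel_measurable_kac_kernel assms)
    moreover have "mult_op (cosh_weight \<beta>) (ae_rel `` {kac_transform \<gamma> f})
        = ae_rel `` {\<lambda>x. of_real (cosh_weight \<beta> x) * kac_transform \<gamma> f x}"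
      by (intro mult_op_class sq_integrable_kac_transform
          sq_integrable_cosh_weight_kac_transform f assms) measurable
    ultimately show ?thesis
      unfolding T_def T'_def[abs_def]
      by (simp add: L2_scale_class sq_integrable_cosh_weight_kac_transform f assms)
  qed
  have U: "U (ae_rel `` {f}) = (\<lambda>z. bargmann f (s * z))" if f: "sq_integrable f" for f
  proof -
    have "f \<in> ae_rel `` {f}"
      by (rule equiv_class_self[OF equiv_ae_rel]) (simp add: f)
    then have "(SOME g. g \<in> ae_rel `` {f}) \<in> ae_rel `` {f}"
      by (rule someI[of "\<lambda>g. g \<in> ae_rel `` {f}"])
    then show ?thesis
      unfolding U_def by (intro ext bargmann_cong_AE) (auto simp: ae_rel_def elim: AE_mp)
  qed
  \<comment> \<open>Isometry applied to the difference of \<open>f\<close> and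
    \<open>g\<close>.\<close>
  have inj: "ae_rel `` {f} = ae_rel `` {g}"
    if f: "sq_integrable f" and g: "sq_integrable g"
      and eq: "(\<lambda>z. bargmann f (s * z)) = (\<lambda>z. bargmann g (s * z))" for f g
  proof -
    have sq: "sq_integrable (\<lambda>x. f x + - 1 * g x)"
      by (intro sq_integrable_add sq_integrable_scale f g)
    have "bargmann (\<lambda>x. f x + - 1 * g x) (s * z) = 0" for z
      unfolding bargmann_add[OF f sq_integrable_scale[OF g]] bargmann_scale
      using fun_cong[OF eq, of z] by simp
    then have "L2_norm_sq (\<lambda>x. f x + - 1 * g x) = 0"
      using bargmann_in_HL2(2)[OF sq s] by simp
    then have "AE x in lborel. (cmod (f x + - 1 * g x))\<^sup>2 = 0"
      using sq unfolding L2_norm_sq_def sq_integrable_def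
      by (subst (asm) integral_nonneg_eq_0_iff_AE) auto
    then show ?thesis
      using f g by (simp add: ae_rel_class_eq_iff)
  qed
  have iso: "hilbert_iso L2 (HL2 t) U"
    unfolding hilbert_iso_def
  proof (intro conjI ballI allI)
    show "bij_betw U (carrier L2) (carrier (HL2 t))"
    proof (rule bij_betwI')
      fix A B assume "A \<in> carrier L2" "B \<in> carrier L2"
      then obtain f g where "sq_integrable f" "A = ae_rel `` {f}" "sq_integrable g" "B = ae_rel `` {g}"
        by (elim L2_carrierE)
      then show "U A = U B \<longleftrightarrow> A = B"
        using inj[of f g] by (metis U)
    next
      fix A assume "A \<in> carrier L2"
      then show "U A \<in> carrier (HL2 t)"
        by (elim L2_carrierE) (simp add: U bargmann_in_HL2(1) s)
    next
      fix F assume "F \<in> carrier (HL2 t)"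
      then obtain f where "sq_integrable f" "F = (\<lambda>z. bargmann f (s * z))"
        using bargmann_surj s by blast
      then show "\<exists>A\<in>carrier L2. F = U A"
        by (intro bexI[of _ "ae_rel `` {f}"]) (auto simp: U class_in_L2_carrier)
    qed
    fix A assume "A \<in> carrier L2"
    then obtain f where f: "sq_integrable f" "A = ae_rel `` {f}" by (rule L2_carrierE)
    show "U (scale L2 a A) = scale (HL2 t) a (U A)" for a
      using f by (simp add: L2_scale_class U sq_integrable_scale bargmann_scale) (simp add: HL2_def)
    fix B assume "B \<in> carrier L2"
    then obtain g where g: "sq_integrable g" "B = ae_rel `` {g}" by (rule L2_carrierE)
    show "U (plus L2 A B) = plus (HL2 t) (U A) (U B)"
      using f g by (simp add: L2_plus_class U sq_integrable_add bargmann_add) (simp add: HL2_def)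
    show "inner_prod (HL2 t) (U A) (U B) = inner_prod L2 A B"
      using f g s by (simp add: U L2_inner_class L2_inner_bargmann)
  qed
  have bij: "bij_betw U (carrier L2) (carrier (HL2 t))"
    using iso by (simp add: hilbert_iso_def)
  have Tcar: "T \<in> carrier L2 \<rightarrow> carrier L2"
    by (auto elim!: L2_carrierE simp: T intro!: class_in_L2_carrier T'sq)
  have inter: "ruelle l \<beta> F = (U \<circ> T \<circ> inv_into (carrier L2) U) F" if F: "F \<in> carrier (HL2 t)" for F
  proof -
    define A where "A = inv_into (carrier L2) U F"
    have A: "A \<in> carrier L2" "U A = F"
      using F bij by (auto simp: A_def bij_betw_def inv_into_into f_inv_into_f)
    then obtain f where f: "sq_integrable f" "A = ae_rel `` {f}" by (elim L2_carrierE)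
    have "U (T A) = (\<lambda>z. ruelle l \<beta> (\<lambda>z. bargmann f (s * z)) z)"
      unfolding f(2) T[OF f(1)] U[OF T'sq[OF f(1)]] unfolding T'_def s_def
      by (intro ext bargmann_ruelle assms f)
    also have "\<dots> = ruelle l \<beta> F"
      using A f by (simp add: U)
    finally show ?thesis by (simp add: A_def)
  qed
  \<comment> \<open>The intertwining identity itself shows that the Ruelle operator preserves the
    space: its value is \<open>U\<close> of an element of \<open>L2\<close>.\<close>
  have "ruelle l \<beta> F \<in> carrier (HL2 t)" if "F \<in> carrier (HL2 t)" for F
  proof -
    have "inv_into (carrier L2) U F \<in> carrier L2"
      using that bij by (auto simp: bij_betw_def inv_into_into)
    then have "T (inv_into (carrier L2) U F) \<in> carrier L2"
      using Tcar by blast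
    then show ?thesis
      using bij inter[OF that] by (auto simp: bij_betw_def)
  qed
  then show ?thesis
    unfolding conjugate_operators_def t_def[symmetric] T_def[symmetric]
    using Tcar iso inter by blast
qed

end
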